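(* Fix absolute constants $C_\Delta,c_1,c_2>0$ for which the tail bound (T) in the context holds for all instances of the model. There is an absolute constant $C>0$ such that the following holds. Let $n\ge d$, $1\le k<d$, let $A\in\mathbb{R}^{n\times d}$ and its entrywise stochastic rounding $\tilde A=A+E$ with resolution $\rho$ both have full column rank ($\tilde A$ almost surely), and suppose $g:=\lambda_k-\lambda_{k+1}>0$, where $\lambda_i=\sigma_i(A)^2$. Put $$\alpha=\frac2g\,C_\Delta\left(\sigma_1(A)\rho\sqrt d+\rho^2n\right),\qquad \beta=\frac2g\left(2\sigma_1(A)\rho\sqrt{nd}+\rho^2nd\right),$$ and assume $\alpha<1$ and $\beta<1$. Then $$\mathcal{T}\ \ge\ \sum_{j=k+1}^d\nu_j^\downarrow-\frac Cg\left[\rho^2\sum_{i=1}^k\sum_{j=k+1}^d(\lambda_i+\lambda_j)+\sum_{j=1}^k(\nu_j^\downarrow)^2+\rho^4n\,k(d-k)\right]-\mathcal{R},$$ where $$\mathcal{R}=\frac{Cd}{g}\left(2(\lambda_1-\lambda_k)+\pi g\right)\left(\lambda_1+\frac g2\right)\left(\frac{\alpha^3}{1-\alpha}+c_1e^{-c_2d}\,\frac{\beta^3}{1-\beta}\right).$$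
   Context: Stochastic rounding (uniformly dithered quantizer): given $R>0$ with $|A_{ij}|\le R$ for all $i,j$ and an integer bit-budget $B\ge 1$, let $M=2^B$, let $q_1<\dots<q_M$ be evenly spaced points with $q_1=-R$, $q_M=R$, and let $\rho=2R/(M-1)$ be the spacing (resolution). For $x\in[q_k,q_{k+1}]$, $Q_\rho(x)=q_{k+1}$ with probability $(x-q_k)/\rho$ and $Q_\rho(x)=q_k$ otherwise. The matrix $\tilde A$ has entries $\tilde A_{ij}=Q_\rho(A_{ij})$, rounded independently over $(i,j)$, and $E=\tilde A-A$. Thus the entries of $E$ are independent, centered, satisfy $|E_{ij}|\le\rho$, and $\mathrm{Var}(E_{ij})\le\rho^2/4$. $\sigma_1(\cdot)\ge\dots\ge\sigma_d(\cdot)$ are singular values. $\nu_j=\sum_{i=1}^n\mathrm{Var}(E_{ij})$, and $\nu_1^\downarrow\ge\dots\ge\nu_d^\downarrow$ is the decreasing rearrangement of $\nu_1,\dots,\nu_d$. The expected excess tail energy is $$\mathcal{T}=\mathbb{E}\left[\sum_{i=k+1}^d\sigma_i(\tilde A)^2\right]-\sum_{i=k+1}^d\sigma_i(A)^2 .$$ Let $\Delta=\tilde A^\top\tilde A-A^\top A$. Tail bound (T): for all $n\ge d$, all $A\in\mathbb{R}^{n\times d}$ of full column rank, and all resolutions $\rho=2R/(2^B-1)$ with $R>0$, $R\ge\max_{i,j}|A_{ij}|$ and $B\ge1$ an integer, $\mathbb{P}\{\|\Delta\|_2\le C_\Delta(\sigma_1(A)\rho\sqrt d+\rho^2n)\}\ge1-c_1e^{-c_2d}$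 ($\|\cdot\|_2$ is the spectral norm). Absolute constants with this property exist. The absolute constant $C$ may depend on the choice of $C_\Delta,c_1,c_2$ only. *)

theory Defs
  imports
    "HOL-Probability.Probability"
    "Jordan_Normal_Form.Char_Poly"
    "Jordan_Normal_Form.DL_Rank"
begin

text \<open>
  Matrices are those of \<^theory>\<open>Jordan_Normal_Form.Matrix\<close>, whose dimensions are values, so that
  constants can be chosen uniformly in the dimensions. Their entries are indexed from 0;
  singular values and the rearranged variances below are indexed from 1.
\<close>

definition resolution :: "real \<Rightarrow> nat \<Rightarrow> real" where
  "resolution R B = 2 * R / (2 ^ B - 1)"

definition grid_point :: "real \<Rightarrow> nat \<Rightarrow> nat \<Rightarrow> real" where
  "grid_point R B k = - R + (real k - 1) * resolution R B"

text \<open>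
  An interior grid point lies in two cells; taking the least one is harmless, as both give the
  point mass at that grid point.
\<close>

definition grid_cell :: "real \<Rightarrow> nat \<Rightarrow> real \<Rightarrow> nat" where
  "grid_cell R B x =
     (LEAST k. 1 \<le> k \<and> k < 2 ^ B \<and> grid_point R B k \<le> x \<and> x \<le> grid_point R B (k + 1))"

definition stoch_round :: "real \<Rightarrow> nat \<Rightarrow> real \<Rightarrow> real pmf" where
  "stoch_round R B x =
     (let k = grid_cell R B x in
      map_pmf (\<lambda>b. if b then grid_point R B (k + 1) else grid_point R B k)
        (bernoulli_pmf ((x - grid_point R B k) / resolution R B)))"

text \<open>The law of the rounded matrix: the product measure makes the entries independent.\<close>

definition stoch_round_mat :: "real \<Rightarrow> nat \<Rightarrow> real mat \<Rightarrow> real mat pmf" where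
  "stoch_round_mat R B A =
     map_pmf (\<lambda>f. Matrix.mat (dim_row A) (dim_col A) f)
       (Pi_pmf ({..<dim_row A} \<times> {..<dim_col A}) 0 (\<lambda>ij. stoch_round R B (A $$ ij)))"

definition rounding_instance :: "nat \<Rightarrow> nat \<Rightarrow> real \<Rightarrow> nat \<Rightarrow> real mat \<Rightarrow> bool" where
  "rounding_instance n d R B A \<longleftrightarrow>
     A \<in> carrier_mat n d \<and> R > 0 \<and> B \<ge> 1 \<and> (\<forall>i<n. \<forall>j<d. \<bar>A $$ (i, j)\<bar> \<le> R)"

definition full_column_rank :: "real mat \<Rightarrow> bool" where
  "full_column_rank A \<longleftrightarrow> vec_space.rank (dim_row A) A = dim_col A"

text \<open>
  The singular values are the square roots of the eigenvalues of the Gram matrix, listed in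
  decreasing order with multiplicity.
\<close>

definition singular_values :: "real mat \<Rightarrow> real list" where
  "singular_values A =
     rev (sorted_list_of_multiset (image_mset sqrt (proots (char_poly (transpose_mat A * A)))))"

definition singular_value :: "nat \<Rightarrow> real mat \<Rightarrow> real" where
  "singular_value i A = singular_values A ! (i - 1)"

definition euclidean_norm :: "real Matrix.vec \<Rightarrow> real" where
  "euclidean_norm v = sqrt (scalar_prod v v)"

definition spectral_norm :: "real mat \<Rightarrow> real" where
  "spectral_norm A =
     (SUP v \<in> {v \<in> carrier_vec (dim_col A). euclidean_norm v = 1}. euclidean_norm (A *\<^sub>v v))"

definition column_variance :: "real \<Rightarrow> nat \<Rightarrow> real mat \<Rightarrow> nat \<Rightarrow> real" where
  "column_variance R B A j =
     (\<Sum>i<dim_row A. measure_pmf.variance (stoch_round_mat R B A) (\<lambda>A'. (A' - A) $$ (i, j)))"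

definition column_variance_desc :: "real \<Rightarrow> nat \<Rightarrow> real mat \<Rightarrow> nat \<Rightarrow> real" where
  "column_variance_desc R B A j =
     rev (sort (map (column_variance R B A) [0..<dim_col A])) ! (j - 1)"

definition excess_tail_energy :: "real \<Rightarrow> nat \<Rightarrow> nat \<Rightarrow> real mat \<Rightarrow> real" where
  "excess_tail_energy R B k A =
     measure_pmf.expectation (stoch_round_mat R B A)
       (\<lambda>A'. \<Sum>i = k + 1..dim_col A. (singular_value i A')\<^sup>2)
     - (\<Sum>i = k + 1..dim_col A. (singular_value i A)\<^sup>2)"

definition gram_tail_bound :: "real \<Rightarrow> real \<Rightarrow> real \<Rightarrow> bool" where
  "gram_tail_bound C\<^sub>\<Delta> c\<^sub>1 c\<^sub>2 \<longleftrightarrow>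
     (\<forall>n d R B A. 1 \<le> d \<and> d \<le> n \<and> rounding_instance n d R B A \<and> full_column_rank A \<longrightarrow>
        measure_pmf.prob (stoch_round_mat R B A)
          {A'. spectral_norm (transpose_mat A' * A' - transpose_mat A * A)
               \<le> C\<^sub>\<Delta> * (singular_value 1 A * resolution R B * sqrt (real d)
                          + (resolution R B)\<^sup>2 * real n)}
        \<ge> 1 - c\<^sub>1 * exp (- c\<^sub>2 * real d))"

end

theory Submission
  imports Defs "Jordan_Normal_Form.Schur_Decomposition"
begin

text \<open>
  By the trace identity, the excess tail energy is the total noise variance minus the expected
  growth of the sum of the top \<open>k\<close> eigenvalues of the Gram matrix. Let \<open>\<Delta>\<close> be the perturbation of
  the Gram matrix, written in an eigenbasis of \<open>A\<^sup>T A\<close>. No contour integral and no genuine third-order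
  expansion is needed. If the first \<open>k\<close> perturbed eigenvectors put mass \<open>s\<close> on the unperturbed tail,
  then the growth exceeds its first-order part \<open>\<Sum>i<k. \<Delta> i i\<close> by at most
  \<open>2 \<parallel>\<Delta>\<parallel> s + 2 \<surd>s F - g s\<close>, where \<open>F\<close> is the Frobenius norm of the off-diagonal block of \<open>\<Delta>\<close>. This is
  at most \<open>2 F\<^sup>2 / g\<close> once \<open>\<parallel>\<Delta>\<parallel> \<le> g / 4\<close>; if \<open>\<parallel>\<Delta>\<parallel> \<le> t g / 2\<close> with \<open>1 / 2 < t < 1\<close>, the crude bound
  \<open>2 k \<parallel>\<Delta>\<parallel>\<close> is already absorbed by \<open>t\<^sup>3 / (1 - t)\<close>. Apply this with \<open>t = \<alpha>\<close> on the likely event and with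
  \<open>t = \<beta>\<close>, which always bounds the noise, elsewhere. The expectation of \<open>F\<^sup>2\<close> follows from second and
  fourth moments of independent centered bounded variables.
\<close>

section \<open>Perturbation of the sum of the top eigenvalues\<close>

lemma sum_if_less_nat:
  fixes f :: "nat \<Rightarrow> real"
  assumes "k \<le> d"
  shows "(\<Sum>i<d. if i < k then f i else 0) = (\<Sum>i<k. f i)"
    and "(\<Sum>i<d. if i < k then 0 else f i) = (\<Sum>i=k..<d. f i)"
proof -
  have "{..<d} \<inter> {i. i < k} = {..<k}" "{..<d} \<inter> - {i. i < k} = {k..<d}"
    using assms by auto
  then show "(\<Sum>i<d. if i < k then f i else 0) = (\<Sum>i<k. f i)"
    and "(\<Sum>i<d. if i < k then 0 else f i) = (\<Sum>i=k..<d. f i)"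
    by (simp_all add: sum.If_cases)
qed

lemma sum_swap3:
  fixes f :: "nat \<Rightarrow> nat \<Rightarrow> nat \<Rightarrow> real"
  shows "(\<Sum>a\<in>A. \<Sum>i\<in>B. \<Sum>j\<in>C. f a i j) = (\<Sum>i\<in>B. \<Sum>j\<in>C. \<Sum>a\<in>A. f a i j)"
  by (rule trans[OF sum.swap]) (rule sum.cong[OF refl sum.swap])

lemma sum_lessThan_split_nat:
  fixes f :: "nat \<Rightarrow> real"
  assumes "k \<le> d"
  shows "(\<Sum>i<d. f i) = (\<Sum>i<k. f i) + (\<Sum>i=k..<d. f i)"
  using sum.atLeastLessThan_concat[of 0 k d f] assms by (simp add: atLeast0LessThan)

text \<open>
  Everything is expressed in an orthonormal eigenbasis of the unperturbed form: \<open>lam\<close> are its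
  eigenvalues, \<open>D\<close> is the perturbation, and row \<open>a\<close> of \<open>c\<close> is the \<open>a\<close>-th eigenvector of the
  perturbed form, with eigenvalue \<open>mu a\<close>. The bound is governed by the mass \<open>s\<close> that the first
  \<open>k\<close> perturbed eigenvectors put on the unperturbed tail: moving that mass costs \<open>g * s\<close>.
\<close>

locale perturbed_eigenbasis =
  fixes d k :: nat and c D :: "nat \<Rightarrow> nat \<Rightarrow> real" and lam mu :: "nat \<Rightarrow> real"
    and g \<delta> :: real
  assumes k_le: "k \<le> d"
    and rows: "\<And>a b. a < d \<Longrightarrow> b < d \<Longrightarrow> (\<Sum>i<d. c a i * c b i) = (if a = b then 1 else 0)"
    and cols: "\<And>i j. i < d \<Longrightarrow> j < d \<Longrightarrow> (\<Sum>a<d. c a i * c a j) = (if i = j then 1 else 0)"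
    and D_sym: "\<And>i j. i < d \<Longrightarrow> j < d \<Longrightarrow> D i j = D j i"
    and mu_eq: "\<And>a. a < d \<Longrightarrow>
       mu a = (\<Sum>i<d. lam i * (c a i)\<^sup>2) + (\<Sum>i<d. \<Sum>j<d. c a i * c a j * D i j)"
    and D_bound: "\<And>x. \<bar>\<Sum>i<d. \<Sum>j<d. x i * x j * D i j\<bar> \<le> \<delta> * (\<Sum>i<d. (x i)\<^sup>2)"
    and gap: "\<And>i j. i < k \<Longrightarrow> k \<le> j \<Longrightarrow> j < d \<Longrightarrow> lam j + g \<le> lam i"
begin

definition s :: real where "s = (\<Sum>a<k. \<Sum>j=k..<d. (c a j)\<^sup>2)"

definition F2 :: real where "F2 = (\<Sum>i<k. \<Sum>j=k..<d. (D i j)\<^sup>2)"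

lemma s_nonneg: "0 \<le> s" and F2_nonneg: "0 \<le> F2"
  by (auto simp: s_def F2_def intro!: sum_nonneg)

lemma head_defect:
  assumes "i < k"
  shows "1 - (\<Sum>a<k. (c a i)\<^sup>2) = (\<Sum>a=k..<d. (c a i)\<^sup>2)"
  using cols[of i i] assms k_le sum_lessThan_split_nat[OF k_le, of "\<lambda>a. (c a i)\<^sup>2"]
  by (simp add: power2_eq_square)

text \<open>The squared entries of \<open>c\<close> form a doubly stochastic matrix, so the mass
  that leaves its leading k x k block is the same counted by rows or by columns: both are k minus
  the mass of that block.\<close>

lemma s_alt: "(\<Sum>i<k. \<Sum>a=k..<d. (c a i)\<^sup>2) = s"
proof -
  have "(\<Sum>i<k. \<Sum>a=k..<d. (c a i)\<^sup>2) = (\<Sum>i<k. 1 - (\<Sum>a<k. (c a i)\<^sup>2))"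
    by (intro sum.cong) (auto simp: head_defect)
  also have "\<dots> = (\<Sum>a<k. 1 - (\<Sum>i<k. (c a i)\<^sup>2))"
    by (simp add: sum_subtractf) (rule sum.swap)
  also have "\<dots> = s"
    unfolding s_def
  proof (intro sum.cong refl)
    fix a assume "a \<in> {..<k}"
    then show "1 - (\<Sum>i<k. (c a i)\<^sup>2) = (\<Sum>j=k..<d. (c a j)\<^sup>2)"
      using rows[of a a] k_le sum_lessThan_split_nat[OF k_le, of "\<lambda>i. (c a i)\<^sup>2"]
      by (simp add: power2_eq_square)
  qed
  finally show ?thesis .
qed

text \<open>The head eigenvalues lose total weight \<open>s\<close> and the tail eigenvalues gain
  the same weight by \<open>s_alt\<close>. Every head eigenvalue is at least \<open>M + g\<close>
  and every tail eigenvalue at most \<open>M\<close>, so each unit of moved weight costs at least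
  \<open>g\<close>.\<close>

lemma gap_cost:
  "(\<Sum>a<k. \<Sum>i<d. lam i * (c a i)\<^sup>2) - (\<Sum>i<k. lam i) \<le> - g * s"
\<comment> \<open>With an empty head or an empty tail no mass can move; otherwise the tail is
  nonempty and its maximum \<open>M\<close> exists.\<close>
proof (cases "k = 0 \<or> k = d")
  case True
  then show ?thesis
  proof
    assume k0: "k = 0"
    then have "s = 0" unfolding s_def by simp
    then show ?thesis using k0 by simp
  next
    assume kd: "k = d"
    have "(\<Sum>a<k. \<Sum>i<d. lam i * (c a i)\<^sup>2) = (\<Sum>i<d. lam i * (\<Sum>a<d. (c a i)\<^sup>2))"
      by (subst sum.swap) (simp add: kd sum_distrib_left)
    also have "\<dots> = (\<Sum>i<d. lam i)"
      using cols by (intro sum.cong) (auto simp: power2_eq_square)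
    finally have "(\<Sum>a<k. \<Sum>i<d. lam i * (c a i)\<^sup>2) = (\<Sum>i<d. lam i)" .
    moreover have "s = 0" unfolding s_def using kd by simp
    ultimately show ?thesis using kd by simp
  qed
next
  case False
  then have k: "0 < k" "k < d" using k_le by auto
  define M where "M = Max (lam ` {k..<d})"
  have M: "lam j \<le> M" if "k \<le> j" "j < d" for j
    using that by (auto simp: M_def)
  have "M \<in> lam ` {k..<d}" unfolding M_def using k by (intro Max_in) auto
  then have L: "M + g \<le> lam i" if "i < k" for i
    using gap that by auto
  have "(\<Sum>a<k. \<Sum>i<d. lam i * (c a i)\<^sup>2) - (\<Sum>i<k. lam i)
      = (\<Sum>i<d. lam i * (\<Sum>a<k. (c a i)\<^sup>2)) - (\<Sum>i<k. lam i)"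
    by (subst sum.swap) (simp add: sum_distrib_left)
  also have "\<dots> = (\<Sum>j=k..<d. lam j * (\<Sum>a<k. (c a j)\<^sup>2)) - (\<Sum>i<k. lam i * (\<Sum>a=k..<d. (c a i)\<^sup>2))"
    by (subst sum_lessThan_split_nat[OF k_le])
       (simp add: head_defect [symmetric] right_diff_distrib sum_subtractf)
  also have "\<dots> \<le> (\<Sum>j=k..<d. M * (\<Sum>a<k. (c a j)\<^sup>2)) - (\<Sum>i<k. (M + g) * (\<Sum>a=k..<d. (c a i)\<^sup>2))"
    by (intro diff_mono sum_mono mult_right_mono M L sum_nonneg) auto
  also have "(\<Sum>j=k..<d. M * (\<Sum>a<k. (c a j)\<^sup>2)) = M * s"
    unfolding s_def sum_distrib_left by (rule sum.swap)
  also have "(\<Sum>i<k. (M + g) * (\<Sum>a=k..<d. (c a i)\<^sup>2)) = (M + g) * s"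
    by (simp add: s_alt [symmetric] sum_distrib_left)
  finally show ?thesis by (simp add: algebra_simps)
qed

lemma excess_le_form:
  "(\<Sum>a<k. mu a) - (\<Sum>i<k. lam i) \<le> (\<Sum>a<k. \<Sum>i<d. \<Sum>j<d. c a i * c a j * D i j) - g * s"
proof -
  have "(\<Sum>a<k. mu a) = (\<Sum>a<k. (\<Sum>i<d. lam i * (c a i)\<^sup>2))
      + (\<Sum>a<k. \<Sum>i<d. \<Sum>j<d. c a i * c a j * D i j)"
    unfolding sum.distrib[of _ _ "{..<k}", symmetric]
    by (rule sum.cong) (use k_le in \<open>simp_all add: mu_eq\<close>)
  then show ?thesis using gap_cost by simp
qed

lemma diag_bound:
  assumes "i < d"
  shows "\<bar>D i i\<bar> \<le> \<delta>"
proof -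
  have "(\<Sum>p<d. \<Sum>q<d. (if p = i then 1 else 0) * (if q = i then 1 else 0) * D p q)
      = (\<Sum>p<d. \<Sum>q<d. if q = i then (if p = i then D p q else 0) else 0)"
    by (intro sum.cong refl) auto
  also have "\<dots> = D i i"
    using assms by simp
  finally have "(\<Sum>p<d. \<Sum>q<d. (if p = i then 1 else 0) * (if q = i then 1 else 0) * D p q) = D i i" .
  moreover have "(\<Sum>p<d. (if p = i then 1 else (0::real))\<^sup>2) = (\<Sum>p<d. if p = i then 1 else 0)"
    by (intro sum.cong refl) auto
  ultimately show ?thesis
    using assms D_bound[of "\<lambda>p. if p = i then 1 else 0"] by simp
qed

text \<open>The crude bound for large perturbations: one \<delta> for each perturbed unit vector and
  one \<delta> for each subtracted diagonal entry, while the gap term has a favourable sign.\<close>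

lemma excess_le_trivial:
  assumes "0 \<le> g"
  shows "(\<Sum>a<k. mu a) - (\<Sum>i<k. lam i) - (\<Sum>i<k. D i i) \<le> 2 * real k * \<delta>"
proof -
  have "(\<Sum>a<k. \<Sum>i<d. \<Sum>j<d. c a i * c a j * D i j) \<le> (\<Sum>a<k. \<delta>)"
  proof (intro sum_mono)
    fix a assume "a \<in> {..<k}"
    then have "(\<Sum>i<d. (c a i)\<^sup>2) = 1"
      using rows[of a a] k_le by (simp add: power2_eq_square)
    then show "(\<Sum>i<d. \<Sum>j<d. c a i * c a j * D i j) \<le> \<delta>"
      using D_bound[of "c a"] by simp
  qed
  moreover have "- (\<Sum>i<k. D i i) \<le> (\<Sum>i<k. \<delta>)"
    unfolding sum_negf [symmetric]
  proof (intro sum_mono)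
    fix i assume "i \<in> {..<k}"
    then show "- D i i \<le> \<delta>" using diag_bound[of i] k_le by auto
  qed
  moreover have "0 \<le> g * s" using assms s_nonneg by simp
  ultimately show ?thesis using excess_le_form by simp
qed

text \<open>\<open>Q\<close> is the orthogonal projection onto the first \<open>k\<close> perturbed
  eigenvectors. Cauchy-Schwarz separates it from \<open>D\<close>, and the squared norm of column
  \<open>j\<close> of a projection is its diagonal entry \<open>Q j j\<close>; over the tail these
  add up to \<open>s\<close>.\<close>

lemma cross_bound:
  "(\<Sum>a<k. \<Sum>i<k. \<Sum>j=k..<d. c a i * c a j * D i j) \<le> sqrt s * sqrt F2"
proof -
  define Q where "Q i j = (\<Sum>a<k. c a i * c a j)" for i j
  have "(\<Sum>a<k. \<Sum>i<k. \<Sum>j=k..<d. c a i * c a j * D i j)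
      = (\<Sum>i<k. \<Sum>a<k. \<Sum>j=k..<d. c a i * c a j * D i j)"
    by (rule sum.swap)
  also have "\<dots> = (\<Sum>i<k. \<Sum>j=k..<d. Q i j * D i j)"
    unfolding Q_def sum_distrib_right by (intro sum.cong refl sum.swap)
  also have "\<dots> = (\<Sum>(i,j)\<in>{..<k} \<times> {k..<d}. Q i j * D i j)"
    by (rule sum.cartesian_product)
  finally have step: "(\<Sum>a<k. \<Sum>i<k. \<Sum>j=k..<d. c a i * c a j * D i j)
      = (\<Sum>(i,j)\<in>{..<k} \<times> {k..<d}. Q i j * D i j)" .
  have "(\<Sum>(i,j)\<in>{..<k} \<times> {k..<d}. Q i j * D i j) \<le> sqrt (\<Sum>(i,j)\<in>{..<k} \<times> {k..<d}. (Q i j)\<^sup>2) * sqrt (\<Sum>(i,j)\<in>{..<k} \<times> {k..<d}. (D i j)\<^sup>2)"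
    unfolding case_prod_beta
    by (rule order_trans[OF _ L2_set_mult_ineq[unfolded L2_set_def]], rule sum_mono)
       (simp flip: abs_mult)
  also have "(\<Sum>(i,j)\<in>{..<k} \<times> {k..<d}. (D i j)\<^sup>2) = F2"
    unfolding F2_def by (rule sum.cartesian_product [symmetric])
  finally have cs: "(\<Sum>(i,j)\<in>{..<k} \<times> {k..<d}. Q i j * D i j)
      \<le> sqrt (\<Sum>(i,j)\<in>{..<k} \<times> {k..<d}. (Q i j)\<^sup>2) * sqrt F2" .
  have "(\<Sum>(i,j)\<in>{..<k} \<times> {k..<d}. (Q i j)\<^sup>2) = (\<Sum>i<k. \<Sum>j=k..<d. (Q i j)\<^sup>2)"
    by (rule sum.cartesian_product [symmetric])
  \<comment> \<open>Whole columns are needed before orthonormality of the rows of \<open>c\<close>,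
    that is, idempotence of \<open>Q\<close>, can be applied.\<close>
  also have "\<dots> \<le> (\<Sum>i<d. \<Sum>j=k..<d. (Q i j)\<^sup>2)"
    using k_le by (intro sum_mono2) (auto intro: sum_nonneg)
  also have "\<dots> = (\<Sum>j=k..<d. \<Sum>i<d. (Q i j)\<^sup>2)"
    by (rule sum.swap)
  also have "\<dots> = (\<Sum>j=k..<d. \<Sum>a<k. (c a j)\<^sup>2)"
  proof (rule sum.cong[OF refl])
    fix j assume "j \<in> {k..<d}"
    have "(\<Sum>i<d. (Q i j)\<^sup>2) = (\<Sum>i<d. \<Sum>a<k. \<Sum>b<k. (c a j * c b j) * (c a i * c b i))"
      unfolding Q_def power2_eq_square sum_product by (simp add: algebra_simps)
    also have "\<dots> = (\<Sum>a<k. \<Sum>b<k. (c a j * c b j) * (\<Sum>i<d. c a i * c b i))"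
      unfolding sum_distrib_left
      by (rule sum_swap3)
    also have "\<dots> = (\<Sum>a<k. \<Sum>b<k. if a = b then c a j * c b j else 0)"
      using k_le by (intro sum.cong refl) (auto simp: rows)
    also have "\<dots> = (\<Sum>a<k. (c a j)\<^sup>2)"
      by (simp add: power2_eq_square)
    finally show "(\<Sum>i<d. (Q i j)\<^sup>2) = (\<Sum>a<k. (c a j)\<^sup>2)" .
  qed
  also have "\<dots> = s"
    unfolding s_def by (rule sum.swap)
  finally have "sqrt (\<Sum>(i,j)\<in>{..<k} \<times> {k..<d}. (Q i j)\<^sup>2) * sqrt F2 \<le> sqrt s * sqrt F2"
    by (intro mult_right_mono) (auto simp: F2_nonneg)
  then show ?thesis using step cs by linarith
qed

lemma form_split:
  "(\<Sum>i<d. \<Sum>j<d. x i * x j * D i j)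
    = (\<Sum>i<k. \<Sum>j<k. x i * x j * D i j) + 2 * (\<Sum>i<k. \<Sum>j=k..<d. x i * x j * D i j)
      + (\<Sum>i=k..<d. \<Sum>j=k..<d. x i * x j * D i j)"
proof -
  have "(\<Sum>i=k..<d. \<Sum>j<k. x i * x j * D i j) = (\<Sum>j<k. \<Sum>i=k..<d. x i * x j * D i j)"
    by (rule sum.swap)
  also have "\<dots> = (\<Sum>i<k. \<Sum>j=k..<d. x i * x j * D i j)"
    using k_le by (intro sum.cong refl) (simp add: D_sym)
  finally show ?thesis
    unfolding sum_lessThan_split_nat[OF k_le] sum.distrib by linarith
qed

text \<open>Padding \<open>x\<close> with zeros turns the head block into an instance of
  \<open>D_bound\<close>.\<close>

lemma head_form_bound:
  "\<bar>\<Sum>i<k. \<Sum>j<k. x i * x j * D i j\<bar> \<le> \<delta> * (\<Sum>i<k. (x i)\<^sup>2)"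
proof -
  have "(\<Sum>i<d. \<Sum>j<d. (if i < k then x i else 0) * (if j < k then x j else 0) * D i j)
      = (\<Sum>i<d. if i < k then (\<Sum>j<d. if j < k then x i * x j * D i j else 0) else 0)"
    by (intro sum.cong refl) (auto intro!: sum.cong)
  also have "\<dots> = (\<Sum>i<k. \<Sum>j<k. x i * x j * D i j)"
    by (simp only: sum_if_less_nat[OF k_le])
  finally have 1: "(\<Sum>i<d. \<Sum>j<d. (if i < k then x i else 0) * (if j < k then x j else 0) * D i j)
      = (\<Sum>i<k. \<Sum>j<k. x i * x j * D i j)" .
  have "(\<Sum>i<d. (if i < k then x i else 0)\<^sup>2) = (\<Sum>i<d. if i < k then (x i)\<^sup>2 else 0)"
    by (intro sum.cong) auto
  then have 2: "(\<Sum>i<d. (if i < k then x i else 0)\<^sup>2) = (\<Sum>i<k. (x i)\<^sup>2)"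
    by (simp only: sum_if_less_nat[OF k_le])
  show ?thesis
    using D_bound[of "\<lambda>i. if i < k then x i else 0"] unfolding 1 2 .
qed

lemma tail_form_bound:
  "\<bar>\<Sum>i=k..<d. \<Sum>j=k..<d. x i * x j * D i j\<bar> \<le> \<delta> * (\<Sum>i=k..<d. (x i)\<^sup>2)"
proof -
  have "(\<Sum>i<d. \<Sum>j<d. (if i < k then 0 else x i) * (if j < k then 0 else x j) * D i j)
      = (\<Sum>i<d. if i < k then 0 else (\<Sum>j<d. if j < k then 0 else x i * x j * D i j))"
    by (intro sum.cong refl) (auto intro!: sum.cong)
  also have "\<dots> = (\<Sum>i=k..<d. \<Sum>j=k..<d. x i * x j * D i j)"
    by (simp only: sum_if_less_nat[OF k_le])
  finally have 1: "(\<Sum>i<d. \<Sum>j<d. (if i < k then 0 else x i) * (if j < k then 0 else x j) * D i j)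
      = (\<Sum>i=k..<d. \<Sum>j=k..<d. x i * x j * D i j)" .
  have "(\<Sum>i<d. (if i < k then 0 else x i)\<^sup>2) = (\<Sum>i<d. if i < k then 0 else (x i)\<^sup>2)"
    by (intro sum.cong) auto
  then have 2: "(\<Sum>i<d. (if i < k then 0 else x i)\<^sup>2) = (\<Sum>i=k..<d. (x i)\<^sup>2)"
    by (simp only: sum_if_less_nat[OF k_le])
  show ?thesis
    using D_bound[of "\<lambda>i. if i < k then 0 else x i"] unfolding 1 2 .
qed

text \<open>Each form splits into head, cross and tail blocks. Over all \<open>a < d\<close> the
  head blocks would sum exactly to the diagonal of \<open>D\<close>; the missing rows
  \<open>a >= k\<close> cost \<delta> times their head mass, which is \<open>s\<close>. The tail
  blocks of the first \<open>k\<close> rows cost another \<delta> times \<open>s\<close>, and the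
  cross blocks are \<open>cross_bound\<close>.\<close>

lemma form_head_sum:
  "(\<Sum>a<k. \<Sum>i<d. \<Sum>j<d. c a i * c a j * D i j) - (\<Sum>i<k. D i i) \<le> 2 * \<delta> * s + 2 * sqrt s * sqrt F2"
proof -
  have "(\<Sum>a<d. \<Sum>i<k. \<Sum>j<k. c a i * c a j * D i j) = (\<Sum>i<k. \<Sum>j<k. (\<Sum>a<d. c a i * c a j) * D i j)"
    unfolding sum_distrib_right by (rule sum_swap3)
  also have "\<dots> = (\<Sum>i<k. \<Sum>j<k. if i = j then D i j else 0)"
    using k_le by (intro sum.cong refl) (auto simp: cols)
  also have "\<dots> = (\<Sum>i<k. D i i)" by simp
  finally have "(\<Sum>a<k. \<Sum>i<k. \<Sum>j<k. c a i * c a j * D i j)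
      = (\<Sum>i<k. D i i) - (\<Sum>a=k..<d. \<Sum>i<k. \<Sum>j<k. c a i * c a j * D i j)"
    using sum_lessThan_split_nat[OF k_le, of "\<lambda>a. \<Sum>i<k. \<Sum>j<k. c a i * c a j * D i j"] by simp
  moreover have "- (\<Sum>a=k..<d. \<Sum>i<k. \<Sum>j<k. c a i * c a j * D i j)
      \<le> (\<Sum>a=k..<d. \<delta> * (\<Sum>i<k. (c a i)\<^sup>2))"
    unfolding sum_negf[symmetric, of _ "{k..<d}"]
  proof (rule sum_mono)
    fix a show "- (\<Sum>i<k. \<Sum>j<k. c a i * c a j * D i j) \<le> \<delta> * (\<Sum>i<k. (c a i)\<^sup>2)"
      using head_form_bound[of "c a"] by linarith
  qed
  moreover have "(\<Sum>a=k..<d. \<delta> * (\<Sum>i<k. (c a i)\<^sup>2)) = \<delta> * s"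
    unfolding s_alt[symmetric] sum_distrib_left by (rule sum.swap)
  moreover have "(\<Sum>a<k. \<Sum>i=k..<d. \<Sum>j=k..<d. c a i * c a j * D i j)
      \<le> (\<Sum>a<k. \<delta> * (\<Sum>i=k..<d. (c a i)\<^sup>2))"
  proof (rule sum_mono)
    fix a show "(\<Sum>i=k..<d. \<Sum>j=k..<d. c a i * c a j * D i j) \<le> \<delta> * (\<Sum>i=k..<d. (c a i)\<^sup>2)"
      using tail_form_bound[of "c a"] by linarith
  qed
  moreover have "(\<Sum>a<k. \<delta> * (\<Sum>i=k..<d. (c a i)\<^sup>2)) = \<delta> * s"
    by (simp add: s_def sum_distrib_left)
  ultimately show ?thesis
    using cross_bound unfolding form_split sum.distrib sum_distrib_left[symmetric] by linarith
qed

text \<open>The terms of order \<delta> consume at most half of the gap cost \<open>g * s\<close>.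
  The other half dominates the cross term: as a function of \<open>u\<close>, the expression 2uv -
  (g/2)u^2 has maximum 2v^2/g, which is seen by completing the square.\<close>

lemma excess_le_quadratic:
  assumes "0 < g" "\<delta> \<le> g / 4"
  shows "(\<Sum>a<k. mu a) - (\<Sum>i<k. lam i) - (\<Sum>i<k. D i i) \<le> 2 / g * F2"
proof -
  define u where "u = sqrt s"
  define v where "v = sqrt F2"
  have uv: "u\<^sup>2 = s" "v\<^sup>2 = F2" by (simp_all add: u_def v_def s_nonneg F2_nonneg)
  have "(\<Sum>a<k. mu a) - (\<Sum>i<k. lam i) - (\<Sum>i<k. D i i) \<le> 2 * \<delta> * s - g * s + 2 * u * v"
    using form_head_sum excess_le_form unfolding u_def v_def by linarith
  also have "\<dots> \<le> - (g / 2) * u\<^sup>2 + 2 * u * v"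
    using mult_right_mono[OF assms(2) s_nonneg] unfolding uv by (simp add: algebra_simps)
  also have "\<dots> \<le> 2 / g * v\<^sup>2"
  proof -
    have "(2 * v\<^sup>2 / g - (2 * u * v - g / 2 * u\<^sup>2)) * (2 * g) = (g * u - 2 * v)\<^sup>2"
      using assms(1) by (simp add: power2_eq_square algebra_simps)
    then have "2 * v\<^sup>2 / g - (2 * u * v - g / 2 * u\<^sup>2) = (g * u - 2 * v)\<^sup>2 / (2 * g)"
      using assms(1) by (simp add: eq_divide_eq)
    moreover have "0 \<le> (g * u - 2 * v)\<^sup>2 / (2 * g)" using assms(1) by simp
    ultimately show ?thesis by simp
  qed
  finally show ?thesis unfolding uv .
qed

end

section \<open>Spectral decomposition of a Gram matrix\<close>

text \<open>Complete \<open>v\<close> to a basis and apply Gram-Schmidt, which leaves the first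
  vector unchanged.\<close>

lemma ex_orthogonal_mat_first_col:
  fixes v :: "real Matrix.vec"
  assumes v: "v \<in> carrier_vec n" and v0: "v \<noteq> 0\<^sub>v n" and n: "n \<noteq> 0"
  obtains W c where "W \<in> carrier_mat n n" "transpose_mat W * W = 1\<^sub>m n" "col W 0 = c \<cdot>\<^sub>v v"
proof -
  interpret cof_vec_space n "TYPE(real)" .
  define ws where "ws = gram_schmidt n (basis_completion v)"
  note bc = basis_completion[OF v v0]
  obtain vs where bv: "basis_completion v = v # vs"
    using bc(6,7) n by (cases "basis_completion v") auto
  note gs = gram_schmidt_result[OF bc(2) bc(4) bc(5) refl, folded ws_def]
  have len: "length ws = n" using gs(4) bc(6) by simp
  have ws_in: "ws ! i \<in> carrier_vec n" if "i < n" for i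
    using gs(3) len that by auto
  have hd_ws: "ws ! 0 = v"
    using gram_schmidt_hd[OF v, of vs, folded bv ws_def] len n by (cases ws) auto
  have orth: "(ws ! i \<bullet> ws ! j = 0) = (i \<noteq> j)" if "i < n" "j < n" for i j
    using corthogonalD[OF gs(2), of i j] that len by simp
  \<comment> \<open>\<open>gram_schmidt\<close> produces orthogonal vectors that are not
    normalized.\<close>
  define u where "u i = (1 / sqrt (ws ! i \<bullet> ws ! i)) \<cdot>\<^sub>v (ws ! i)" for i
  define W where "W = mat_of_cols n (map u [0..<n])"
  have u: "u i \<in> carrier_vec n" if "i < n" for i using ws_in[OF that] by (simp add: u_def)
  have W: "W \<in> carrier_mat n n"
    using mat_of_cols_carrier(1)[of n "map u [0..<n]"] by (simp add: W_def)
  have col: "col W i = u i" if "i < n" for i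
    using that u by (simp add: W_def)
  have pos: "ws ! i \<bullet> ws ! i > 0" if "i < n" for i
  proof -
    have "ws ! i \<bullet> ws ! i \<ge> 0" by (simp add: scalar_prod_def sum_nonneg)
    then show ?thesis using orth[OF that that] by linarith
  qed
  have "transpose_mat W * W = 1\<^sub>m n"
  proof (rule eq_matI)
    fix i j assume "i < dim_row (1\<^sub>m n :: real mat)" "j < dim_col (1\<^sub>m n :: real mat)"
    then have ij: "i < n" "j < n" by auto
    have "(transpose_mat W * W) $$ (i, j) = u i \<bullet> u j"
      using W ij by (simp add: col)
    also have "\<dots> = (ws ! i \<bullet> ws ! j) / (sqrt (ws ! i \<bullet> ws ! i) * sqrt (ws ! j \<bullet> ws ! j))"
      using ws_in[OF ij(1)] ws_in[OF ij(2)] by (simp add: u_def)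
    also have "\<dots> = 1\<^sub>m n $$ (i, j)"
      using orth[OF ij] pos[OF ij(1)] ij by (auto simp: real_sqrt_mult[symmetric])
    finally show "(transpose_mat W * W) $$ (i, j) = 1\<^sub>m n $$ (i, j)" .
  qed (use W in auto)
  moreover have "col W 0 = (1 / sqrt (v \<bullet> v)) \<cdot>\<^sub>v v"
    using col[of 0] n by (simp add: u_def hd_ws)
  ultimately show thesis using W that by blast
qed

text \<open>Deflation by induction on the list of roots: rotate an eigenvector for the first root
  into the first coordinate and diagonalize the remaining block. The diagonal follows the order of
  \<open>es\<close>, so a decreasing list of roots yields an ordered eigenbasis.\<close>

lemma symmetric_mat_diagonalizable:
  fixes G :: "real mat"
  assumes "G \<in> carrier_mat n n" "transpose_mat G = G" "char_poly G = (\<Prod>e\<leftarrow>es. [:- e, 1:])"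
  shows "\<exists>U \<in> carrier_mat n n. transpose_mat U * U = 1\<^sub>m n
    \<and> transpose_mat U * G * U = mat n n (\<lambda>(i, j). if i = j then es ! i else 0)"
  using assms
proof (induction es arbitrary: n G)
  case Nil
  then have "n = 0" using degree_monic_char_poly[of G n] by simp
  then show ?case using Nil by (intro bexI[of _ "1\<^sub>m 0"]) auto
next
  case (Cons e es)
  note G = Cons.prems(1) and sym = Cons.prems(2)
  have cp: "char_poly G = [:- e, 1:] * (\<Prod>e\<leftarrow>es. [:- e, 1:])" using Cons.prems(3) by simp
  have mon: "monic (\<Prod>e\<leftarrow>es. [:- e, 1:])" by (rule monic_prod_list) auto
  have "degree (char_poly G) = Suc (degree (\<Prod>e\<leftarrow>es. [:- e, 1:]))"
    unfolding cp by (subst degree_mult_eq) (use mon in auto)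
  then have n: "n \<noteq> 0" using degree_monic_char_poly[OF G] by auto
  define m where "m = n - 1"
  have nm: "n = 1 + m" "Suc m = n" using n by (auto simp: m_def)
  have "eigenvalue G e" unfolding eigenvalue_root_char_poly[OF G] cp by simp
  then obtain v where v: "v \<in> carrier_vec n" "v \<noteq> 0\<^sub>v n" "G *\<^sub>v v = e \<cdot>\<^sub>v v"
    using G unfolding eigenvalue_def eigenvector_def by auto
  obtain W c where W: "W \<in> carrier_mat n n" and WW: "transpose_mat W * W = 1\<^sub>m n"
    and col0: "col W 0 = c \<cdot>\<^sub>v v"
    using ex_orthogonal_mat_first_col[OF v(1,2) n] .
  have WT: "transpose_mat W \<in> carrier_mat n n" using W by simp
  have WW': "W * transpose_mat W = 1\<^sub>m n" using mat_mult_left_right_inverse[OF WT W WW] .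
  define A where "A = transpose_mat W * G * W"
  have A: "A \<in> carrier_mat n n" using W G by (simp add: A_def)
  have A_sym: "transpose_mat A = A"
    using W G WT sym by (simp add: A_def transpose_mult[of _ n n _ n])
  have "G *\<^sub>v col W 0 = e \<cdot>\<^sub>v col W 0"
    unfolding col0 using G v by (simp add: mult_mat_vec smult_smult_assoc mult.commute)
  moreover have "col A 0 = transpose_mat W *\<^sub>v (G *\<^sub>v col W 0)"
    unfolding A_def assoc_mult_mat[OF WT G W]
    using n by (subst col_mult2[OF WT mult_carrier_mat[OF G W]], simp, subst col_mult2[OF G W], auto)
  ultimately have "col A 0 = transpose_mat W *\<^sub>v (e \<cdot>\<^sub>v col W 0)"
    by simp
  also have "\<dots> = e \<cdot>\<^sub>v (transpose_mat W *\<^sub>v col W 0)"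
    by (rule mult_mat_vec[OF WT]) (use W n in auto)
  also have "transpose_mat W *\<^sub>v col W 0 = col (transpose_mat W * W) 0"
    using col_mult2[OF WT W] n by simp
  finally have "col A 0 = e \<cdot>\<^sub>v unit_vec n 0" using WW n by simp
  then have A0: "A $$ (i, 0) = (if i = 0 then e else 0)" if "i < n" for i
    using A n that by (metis carrier_matD index_col index_smult_vec(1) index_unit_vec(1,3) mult.right_neutral mult_zero_right neq0_conv)
  \<comment> \<open>Symmetry carries the vanishing of the first column over to the first row, which
    makes the rotated matrix block diagonal.\<close>
  have A0': "A $$ (0, i) = (if i = 0 then e else 0)" if "i < n" for i
    using A0[OF that] A n that A_sym by (metis carrier_matD index_transpose_mat(1) neq0_conv)
  define A3 where "A3 = mat m m (\<lambda>(i, j). A $$ (Suc i, Suc j))"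
  have A3: "A3 \<in> carrier_mat m m" by (simp add: A3_def)
  have A_block: "A = four_block_mat (mat 1 1 (\<lambda>_. e)) (0\<^sub>m 1 m) (0\<^sub>m m 1) A3"
  proof (rule eq_matI)
    fix i j
    assume "i < dim_row (four_block_mat (mat 1 1 (\<lambda>_. e)) (0\<^sub>m 1 m) (0\<^sub>m m 1) A3)"
      and "j < dim_col (four_block_mat (mat 1 1 (\<lambda>_. e)) (0\<^sub>m 1 m) (0\<^sub>m m 1) A3)"
    then have "i < Suc m" "j < Suc m" by (simp_all add: A3_def)
    then show "A $$ (i, j) = four_block_mat (mat 1 1 (\<lambda>_. e)) (0\<^sub>m 1 m) (0\<^sub>m m 1) A3 $$ (i, j)"
      using A0[of i] A0'[of j] by (cases i; cases j) (auto simp: A3_def nm(2)[symmetric])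
  qed (use A in \<open>auto simp: A3_def nm(2)[symmetric]\<close>)
  have A3_sym: "transpose_mat A3 = A3"
  proof (rule eq_matI)
    fix i j assume "i < dim_row A3" "j < dim_col A3"
    then have ij: "i < m" "j < m" by (simp_all add: A3_def)
    then have "Suc i < n" "Suc j < n" using nm(2) by auto
    then have "A $$ (Suc j, Suc i) = A $$ (Suc i, Suc j)"
      using A A_sym by (metis carrier_matD index_transpose_mat(1))
    then show "transpose_mat A3 $$ (i, j) = A3 $$ (i, j)"
      using ij by (simp add: A3_def)
  qed (simp_all add: A3_def)
  \<comment> \<open>Similarity preserves the characteristic polynomial, and the block form factors
    it. Cancelling the factor of \<open>e\<close> leaves exactly the factorization that the
    induction hypothesis requires for \<open>A3\<close>.\<close>
  have "similar_mat_wit A G (transpose_mat W) W"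
    by (rule similar_mat_witI[OF WW WW' A_def A G WT W])
  then have "char_poly A = char_poly G"
    by (intro char_poly_similar) (auto simp: similar_mat_def)
  moreover have "char_poly A = char_poly (mat 1 1 (\<lambda>_. e)) * char_poly A3"
    unfolding A_block by (rule char_poly_four_block_zeros_col[OF _ _ A3]) auto
  moreover have "char_poly (mat 1 1 (\<lambda>_. e)) = [:- e, 1:]"
    by (simp add: char_poly_defs Determinant.det_def sign_def)
  ultimately have "char_poly A3 = (\<Prod>e\<leftarrow>es. [:- e, 1:])"
    using cp by (metis mult_cancel_left pCons_eq_0_iff zero_neq_one)
  from Cons.IH[OF A3 A3_sym this] obtain U where U: "U \<in> carrier_mat m m"
    and UU: "transpose_mat U * U = 1\<^sub>m m"
    and UAU: "transpose_mat U * A3 * U = mat m m (\<lambda>(i, j). if i = j then es ! i else 0)"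
    by blast
  define V where "V = four_block_mat (1\<^sub>m 1) (0\<^sub>m 1 m) (0\<^sub>m m 1) U"
  have V: "V \<in> carrier_mat n n" unfolding V_def nm(1) using U by (intro four_block_carrier_mat) auto
  have VT: "transpose_mat V = four_block_mat (1\<^sub>m 1) (0\<^sub>m 1 m) (0\<^sub>m m 1) (transpose_mat U)"
    unfolding V_def using U by (subst transpose_four_block_mat) auto
  have VT': "transpose_mat V \<in> carrier_mat n n" using V by simp
  have VV: "transpose_mat V * V = 1\<^sub>m n"
    unfolding VT unfolding V_def using U UU
    by (subst mult_four_block_mat[of _ 1 1 _ m _ m _ _ 1 _ m]) (auto simp: nm(1))
  have VAV: "transpose_mat V * A * V = four_block_mat (mat 1 1 (\<lambda>_. e)) (0\<^sub>m 1 m) (0\<^sub>m m 1) (transpose_mat U * A3 * U)"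
    unfolding VT unfolding V_def A_block using U A3
    by (subst mult_four_block_mat[of _ 1 1 _ m _ m _ _ 1 _ m], simp_all,
        subst mult_four_block_mat[of _ 1 1 _ m _ m _ _ 1 _ m], simp_all)
  show ?case
  proof (intro bexI[of _ "W * V"] conjI)
    have T: "transpose_mat (W * V) = transpose_mat V * transpose_mat W"
      using transpose_mult[OF W V] .
    have "transpose_mat (W * V) * (W * V) = transpose_mat V * (transpose_mat W * W) * V"
      unfolding T using W V WT VT' by (simp add: assoc_mult_mat[of _ n n _ n _ n])
    then show "transpose_mat (W * V) * (W * V) = 1\<^sub>m n" using V VT' VV by (simp add: WW)
    have "transpose_mat (W * V) * G * (W * V) = transpose_mat V * A * V"
      unfolding T A_def using W V WT VT' G by (simp add: assoc_mult_mat[of _ n n _ n _ n])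
    also have "\<dots> = mat n n (\<lambda>(i, j). if i = j then (e # es) ! i else 0)"
      unfolding VAV UAU by (rule eq_matI) (auto simp: nm(1) nth_Cons')
    finally show "transpose_mat (W * V) * G * (W * V) = mat n n (\<lambda>(i, j). if i = j then (e # es) ! i else 0)" .
    show "W * V \<in> carrier_mat n n" using W V by simp
  qed
qed

text \<open>Over the complex numbers the polynomial splits. For an eigenvector x with root a, the
  value of the Hermitian form at x is \<open>a * N\<close>, where \<open>N\<close> is the squared
  norm of x; symmetry makes this value equal to its own conjugate, so a is real.\<close>

lemma symmetric_char_poly_splits:
  fixes G :: "real mat"
  assumes G: "G \<in> carrier_mat n n" and sym: "transpose_mat G = G"
  shows "\<exists>es. char_poly G = (\<Prod>e\<leftarrow>es. [:- e, 1:])"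
proof -
  define H where "H = map_mat complex_of_real G"
  have H: "H \<in> carrier_mat n n" using G by (simp add: H_def)
  obtain as where as: "char_poly H = (\<Prod>a\<leftarrow>as. [:- a, 1:])"
    using char_poly_factorized[OF H] by blast
  have real: "a \<in> \<real>" if "a \<in> set as" for a
  proof -
    have "poly (char_poly H) a = 0"
      unfolding as using that by (auto simp: poly_prod_list prod_list_zero_iff o_def)
    then obtain x where x: "x \<in> carrier_vec n" "x \<noteq> 0\<^sub>v n" "H *\<^sub>v x = a \<cdot>\<^sub>v x"
      using H unfolding eigenvalue_root_char_poly[OF H, symmetric] eigenvalue_def eigenvector_def
      by auto
    have Hx: "(\<Sum>j<n. complex_of_real (G $$ (i, j)) * x $ j) = a * x $ i" if "i < n" for i
      using arg_cong[OF x(3), of "\<lambda>v. v $ i"] that H G x(1)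
      by (simp add: scalar_prod_def H_def atLeast0LessThan)
    define N where "N = (\<Sum>i<n. x $ i * cnj (x $ i))"
    have N: "N = complex_of_real (\<Sum>i<n. (cmod (x $ i))\<^sup>2)"
      by (simp add: N_def complex_norm_square[symmetric])
    have "a * N = (\<Sum>i<n. \<Sum>j<n. complex_of_real (G $$ (i, j)) * x $ j * cnj (x $ i))"
      by (simp add: N_def sum_distrib_left Hx[symmetric] sum_distrib_right mult.assoc[symmetric])
    also have "\<dots> = (\<Sum>j<n. \<Sum>i<n. complex_of_real (G $$ (i, j)) * x $ j * cnj (x $ i))"
      by (rule sum.swap)
    also have "\<dots> = (\<Sum>j<n. \<Sum>i<n. complex_of_real (G $$ (j, i)) * x $ j * cnj (x $ i))"
      using G sym by (intro sum.cong refl) (metis carrier_matD index_transpose_mat(1) lessThan_iff)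
    also have "\<dots> = cnj (\<Sum>i<n. \<Sum>j<n. complex_of_real (G $$ (i, j)) * x $ j * cnj (x $ i))"
      by (simp add: algebra_simps)
    also have "(\<Sum>i<n. \<Sum>j<n. complex_of_real (G $$ (i, j)) * x $ j * cnj (x $ i)) = a * N"
      by (simp add: N_def sum_distrib_left Hx[symmetric] sum_distrib_right mult.assoc[symmetric])
    finally have "a * N = cnj a * N" by (simp add: N)
    moreover have "N \<noteq> 0"
    proof
      assume "N = 0"
      then have "(\<Sum>i<n. (cmod (x $ i))\<^sup>2) = 0" unfolding N of_real_eq_0_iff .
      then have "\<forall>i<n. x $ i = 0" by (simp add: sum_nonneg_eq_0_iff)
      then have "x = 0\<^sub>v n" using x(1) by (intro eq_vecI) auto
      then show False using x(2) by simp
    qed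
    ultimately have "cnj a = a" by (metis mult_cancel_right)
    then show "a \<in> \<real>" by (simp add: Reals_cnj_iff)
  qed
  \<comment> \<open>With all roots real, injectivity of the embedding of real polynomials pulls the
    factorization back.\<close>
  interpret h: map_poly_inj_idom_hom complex_of_real
    by unfold_locales auto
  have "map_poly complex_of_real (char_poly G) = char_poly H"
    unfolding H_def by (rule of_real_hom.char_poly_hom[OF G, symmetric])
  also have "\<dots> = (\<Prod>a\<leftarrow>as. map_poly complex_of_real [:- Re a, 1:])"
  proof -
    have "map_poly complex_of_real [:- Re a, 1:] = [:- a, 1:]" if "a \<in> set as" for a
      using of_real_Re[OF real[OF that]] by (simp add: map_poly_pCons)
    then show ?thesis unfolding as by (simp cong: map_cong)
  qed
  also have "\<dots> = map_poly complex_of_real (\<Prod>b\<leftarrow>map Re as. [:- b, 1:])"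
  proof (induction as)
    case (Cons a as)
    then show ?case by (simp only: list.map prod_list.Cons h.hom_mult)
  qed simp
  finally have "char_poly G = (\<Prod>e\<leftarrow>map Re as. [:- e, 1:])"
    by (simp only: h.eq_iff)
  then show ?thesis by blast
qed

text \<open>The square root is monotone on the whole real line in this setting, so taking roots
  commutes with sorting.\<close>

lemma singular_values_eq:
  assumes "char_poly (transpose_mat A * A) = (\<Prod>e\<leftarrow>es. [:- e, 1:])" "sorted (rev es)"
  shows "singular_values A = map sqrt es"
proof -
  have "proots (\<Prod>e\<leftarrow>es. [:- e, 1:]) = mset es"
  proof (induction es)
    case (Cons e es)
    have "(\<Prod>e\<leftarrow>es. [:- e, 1:]) \<noteq> 0" by (auto simp: prod_list_zero_iff)
    then have "proots ([:- e, 1:] * (\<Prod>e\<leftarrow>es. [:- e, 1:])) = add_mset e (mset es)"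
      by (subst proots_mult) (auto simp: Cons.IH)
    then show ?case by (simp only: list.map prod_list.Cons mset.simps)
  qed simp
  then have "singular_values A = rev (sort (map sqrt es))"
    by (simp add: singular_values_def assms(1) flip: mset_map)
  also have "sort (map sqrt es) = map sqrt (rev es)"
    using assms(2) by (intro properties_for_sort) (auto simp: sorted_map sorted_wrt_mono_rel)
  finally show ?thesis by (simp add: rev_map)
qed

section \<open>Orthonormal right singular vectors\<close>

abbreviation mv :: "real mat \<Rightarrow> nat \<Rightarrow> (nat \<Rightarrow> real) \<Rightarrow> nat \<Rightarrow> real" where
  "mv A d x r \<equiv> \<Sum>c<d. A $$ (r, c) * x c"

text \<open>The vectors \<open>v a\<close> are right singular vectors, given as functions so that
  later arguments are manipulations of finite sums. Orthonormality is recorded for rows and columns,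
  as both change-of-basis directions occur. \<open>Suc a\<close> translates the index from 0 to the
  singular value index from 1.\<close>

definition gram_basis :: "real mat \<Rightarrow> nat \<Rightarrow> nat \<Rightarrow> (nat \<Rightarrow> nat \<Rightarrow> real) \<Rightarrow> bool" where
  "gram_basis A n d v \<longleftrightarrow>
     (\<forall>a<d. \<forall>b<d. (\<Sum>i<d. v a i * v b i) = (if a = b then 1 else 0)) \<and>
     (\<forall>i<d. \<forall>j<d. (\<Sum>a<d. v a i * v a j) = (if i = j then 1 else 0)) \<and>
     (\<forall>a<d. \<forall>b<d. (\<Sum>r<n. mv A d (v a) r * mv A d (v b) r)
        = (if a = b then (singular_value (Suc a) A)\<^sup>2 else 0))"

lemma gram_eigenbasis:
  fixes A :: "real mat"
  assumes A: "A \<in> carrier_mat n d"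
  obtains v :: "nat \<Rightarrow> nat \<Rightarrow> real"
  where "gram_basis A n d v"
    and "\<And>a b. a \<le> b \<Longrightarrow> b < d \<Longrightarrow> (singular_value (Suc b) A)\<^sup>2 \<le> (singular_value (Suc a) A)\<^sup>2"
    and "\<And>a. a < d \<Longrightarrow> 0 \<le> singular_value (Suc a) A"
proof -
  define G where "G = transpose_mat A * A"
  have AT: "transpose_mat A \<in> carrier_mat d n" using A by simp
  have G: "G \<in> carrier_mat d d" using A by (simp add: G_def)
  have sym: "transpose_mat G = G" using transpose_mult[OF AT A] by (simp add: G_def)
  obtain es0 where "char_poly G = (\<Prod>e\<leftarrow>es0. [:- e, 1:])"
    using symmetric_char_poly_splits[OF G sym] by blast
  moreover define es where "es = rev (sort es0)"
  moreover have "(\<Prod>e\<leftarrow>es0. [:- e, 1:]) = (\<Prod>e\<leftarrow>es. [:- e, 1:])"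
    unfolding prod_mset_prod_list[symmetric] by (simp add: es_def)
  ultimately have es: "char_poly G = (\<Prod>e\<leftarrow>es. [:- e, 1:])" "sorted (rev es)" by simp_all
  have len: "length es = d"
    using degree_monic_char_poly[OF G] degree_linear_factors[of uminus es] es(1) by simp
  obtain U where U: "U \<in> carrier_mat d d" and UU: "transpose_mat U * U = 1\<^sub>m d"
    and UGU: "transpose_mat U * G * U = mat d d (\<lambda>(i, j). if i = j then es ! i else 0)"
    using symmetric_mat_diagonalizable[OF G sym es(1)] by blast
  have UT: "transpose_mat U \<in> carrier_mat d d" using U by simp
  have UU': "U * transpose_mat U = 1\<^sub>m d" using mat_mult_left_right_inverse[OF UT U UU] .
  define v where "v a i = U $$ (i, a)" for a i
  have rows: "(\<Sum>i<d. v a i * v b i) = (if a = b then 1 else 0)" if "a < d" "b < d" for a b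
    using arg_cong[OF UU, of "\<lambda>M. M $$ (a, b)"] U that
    by (simp add: v_def scalar_prod_def atLeast0LessThan)
  have cols: "(\<Sum>a<d. v a i * v a j) = (if i = j then 1 else 0)" if "i < d" "j < d" for i j
    using arg_cong[OF UU', of "\<lambda>M. M $$ (i, j)"] U that
    by (simp add: v_def scalar_prod_def atLeast0LessThan)
  define M where "M = A * U"
  have M: "M \<in> carrier_mat n d" using A U by (simp add: M_def)
  have M_entry: "M $$ (r, a) = (\<Sum>i<d. A $$ (r, i) * v a i)" if "r < n" "a < d" for r a
    using A U that by (simp add: M_def v_def scalar_prod_def atLeast0LessThan)
  have "transpose_mat U * G * U = transpose_mat U * (G * U)"
    by (rule assoc_mult_mat[OF UT G U])
  also have "G * U = transpose_mat A * M"
    unfolding G_def M_def by (rule assoc_mult_mat[OF AT A U])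
  also have "transpose_mat U * (transpose_mat A * M) = transpose_mat M * M"
    unfolding M_def transpose_mult[OF A U]
    by (rule assoc_mult_mat[OF UT AT M[unfolded M_def], symmetric])
  finally have MM: "transpose_mat M * M = mat d d (\<lambda>(i, j). if i = j then es ! i else 0)"
    unfolding UGU by simp
  have AU: "(\<Sum>r<n. (\<Sum>i<d. A $$ (r, i) * v a i) * (\<Sum>j<d. A $$ (r, j) * v b j))
        = (if a = b then es ! a else 0)" if "a < d" "b < d" for a b
    using arg_cong[OF MM, of "\<lambda>N. N $$ (a, b)"] M that
    by (simp add: scalar_prod_def atLeast0LessThan M_entry)
  \<comment> \<open>Each eigenvalue is the squared length of the image of its eigenvector; hence
    squaring the singular value \<open>sqrt (es ! a)\<close> returns \<open>es ! a\<close>.\<close>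
  have nonneg: "es ! a \<ge> 0" if "a < d" for a
  proof -
    have "es ! a = (\<Sum>r<n. (\<Sum>i<d. A $$ (r, i) * v a i)\<^sup>2)"
      using AU[OF that that] by (simp add: power2_eq_square)
    then show ?thesis by (simp add: sum_nonneg)
  qed
  have sv: "singular_value (Suc a) A = sqrt (es ! a)" if "a < d" for a
    using singular_values_eq[OF es[unfolded G_def]] that by (simp add: singular_value_def len)
  have mono: "es ! b \<le> es ! a" if "a \<le> b" "b < d" for a b
    using sorted_rev_nth_mono[OF es(2), of a b] that len by simp
  show thesis
    by (rule that[of v]) (use rows cols AU sv nonneg mono in \<open>auto simp: gram_basis_def\<close>)
qed

section \<open>Moments of independent bounded noise\<close>

text \<open>Subtract the threshold \<open>t\<close>, the value of \<phi> at the k-th largest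
  \<open>x\<close>. Weights in [0,1] cannot beat keeping all positive parts \<open>h\<close>, and in
  sorted order those parts live on the first \<open>k\<close> places. Monotonicity is asked on the
  nonnegative reals only, so that both the identity and the square are admissible.\<close>

lemma sum_weighted_le_top:
  fixes \<phi> :: "real \<Rightarrow> real" and w x :: "nat \<Rightarrow> real"
  assumes "1 \<le> k" "k \<le> d"
    and w: "\<And>b. b < d \<Longrightarrow> 0 \<le> w b" "\<And>b. b < d \<Longrightarrow> w b \<le> 1" "(\<Sum>b<d. w b) = real k"
    and x: "\<And>b. b < d \<Longrightarrow> 0 \<le> x b"
    and \<phi>: "mono_on {0..} \<phi>"
  shows "(\<Sum>b<d. w b * \<phi> (x b)) \<le> (\<Sum>j<k. \<phi> (rev (sort (map x [0..<d])) ! j))"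
proof -
  define ys where "ys = rev (sort (map x [0..<d]))"
  have len: "length ys = d" by (simp add: ys_def)
  have mset_ys: "mset ys = mset (map x [0..<d])" by (simp add: ys_def)
  have set_ys: "set ys = x ` {..<d}" by (auto simp: ys_def)
  have ys0: "0 \<le> ys ! j" if "j < d" for j
    using nth_mem[of j ys] that x set_ys by (auto simp: len)
  have dec: "ys ! j \<le> ys ! i" if "i \<le> j" "j < d" for i j
    using sorted_rev_nth_mono[of ys i j] that by (simp add: ys_def len)
  define t where "t = \<phi> (ys ! (k - 1))"
  define h where "h y = max (\<phi> y - t) 0" for y
  have "(\<Sum>b<d. w b * \<phi> (x b)) = (\<Sum>b<d. w b * (\<phi> (x b) - t)) + real k * t"
    using w(3) by (simp add: right_diff_distrib sum_subtractf flip: sum_distrib_right)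
  also have "(\<Sum>b<d. w b * (\<phi> (x b) - t)) \<le> (\<Sum>b<d. h (x b))"
  proof (intro sum_mono)
    fix b assume "b \<in> {..<d}"
    then have "w b * (\<phi> (x b) - t) \<le> w b * h (x b)" "w b * h (x b) \<le> 1 * h (x b)"
      using w by (intro mult_left_mono mult_right_mono; simp add: h_def)+
    then show "w b * (\<phi> (x b) - t) \<le> h (x b)" by simp
  qed
  also have "(\<Sum>b<d. h (x b)) = (\<Sum>j<d. h (ys ! j))"
  proof -
    have "(\<Sum>b<d. h (x b)) = sum_list (map h (map x [0..<d]))"
      by (simp add: interv_sum_list_conv_sum_set_nat atLeast0LessThan o_def)
    also have "\<dots> = sum_mset (image_mset h (mset (map x [0..<d])))"
      by (metis mset_map sum_mset_sum_list)
    also have "\<dots> = sum_list (map h ys)"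
      unfolding mset_ys[symmetric] by (metis mset_map sum_mset_sum_list)
    also have "\<dots> = (\<Sum>j<d. h (ys ! j))"
      by (simp add: sum_list_sum_nth len atLeast0LessThan)
    finally show ?thesis .
  qed
  also have "\<dots> = (\<Sum>j<k. h (ys ! j)) + (\<Sum>j=k..<d. h (ys ! j))"
    using assms(2) by (metis atLeast0LessThan le0 sum.atLeastLessThan_concat)
  also have "(\<Sum>j=k..<d. h (ys ! j)) = 0"
  proof (intro sum.neutral ballI)
    fix j assume "j \<in> {k..<d}"
    then have "\<phi> (ys ! j) \<le> t"
      unfolding t_def using assms(1) dec[of "k - 1" j] ys0
      by (intro mono_onD[OF \<phi>]) auto
    then show "h (ys ! j) = 0" by (simp add: h_def)
  qed
  also have "(\<Sum>j<k. h (ys ! j)) = (\<Sum>j<k. \<phi> (ys ! j) - t)"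
  proof (intro sum.cong refl)
    fix j assume "j \<in> {..<k}"
    then have "t \<le> \<phi> (ys ! j)"
      unfolding t_def using assms(1,2) dec[of j "k - 1"] ys0
      by (intro mono_onD[OF \<phi>]) auto
    then show "h (ys ! j) = \<phi> (ys ! j) - t" by (simp add: h_def)
  qed
  finally show ?thesis
    by (simp add: sum_subtractf ys_def)
qed

section \<open>Expectations under finitely supported product laws\<close>

lemma integrable_Pi_pmf_finite:
  fixes F :: "('a \<Rightarrow> 'b) \<Rightarrow> real"
  assumes "finite I" "\<And>i. i \<in> I \<Longrightarrow> finite (set_pmf (p i))"
  shows "integrable (Pi_pmf I dflt p) F"
proof (rule integrable_measure_pmf_finite)
  have "finite (PiE_dflt I dflt (set_pmf \<circ> p))"
    using assms by (intro finite_PiE_dflt) auto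
  then show "finite (set_pmf (Pi_pmf I dflt p))"
    using assms by (simp add: set_Pi_pmf)
qed

lemma expectation_pair_pmf_mult:
  fixes f :: "'a \<Rightarrow> real" and g :: "'b \<Rightarrow> real"
  assumes "finite (set_pmf p)" "finite (set_pmf q)"
  shows "measure_pmf.expectation (pair_pmf p q) (\<lambda>(x, y). f x * g y)
    = measure_pmf.expectation p f * measure_pmf.expectation q g"
proof -
  have "measure_pmf.expectation (pair_pmf p q) (\<lambda>(x, y). f x * g y)
      = (\<Sum>(x, y)\<in>set_pmf p \<times> set_pmf q. f x * pmf p x * (g y * pmf q y))"
    using assms by (subst integral_measure_pmf_real[where A = "set_pmf p \<times> set_pmf q"])
      (auto simp: pmf_pair intro!: sum.cong)
  also have "\<dots> = (\<Sum>x\<in>set_pmf p. f x * pmf p x) * (\<Sum>y\<in>set_pmf q. g y * pmf q y)"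
    by (simp add: sum_product sum.cartesian_product)
  also have "\<dots> = measure_pmf.expectation p f * measure_pmf.expectation q g"
    using assms by (subst (1 2) integral_measure_pmf_real[where A = "set_pmf _"]) auto
  finally show ?thesis .
qed

text \<open>Independence of disjoint coordinate blocks. That \<open>F\<close> reads only
  \<open>J\<close> is expressed by invariance under changes outside \<open>J\<close>. The product
  law is split at \<open>J\<close>; then \<open>F\<close> sees only the first factor and
  \<open>G\<close> only the second.\<close>

lemma expectation_Pi_pmf_mult:
  fixes F G :: "('a \<Rightarrow> 'b) \<Rightarrow> real"
  assumes fin: "finite I" "\<And>i. i \<in> I \<Longrightarrow> finite (set_pmf (p i))"
    and disj: "J \<subseteq> I" "K \<subseteq> I" "J \<inter> K = {}"
    and F: "\<And>f f'. (\<And>i. i \<in> J \<Longrightarrow> f i = f' i) \<Longrightarrow> F f = F f'"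
    and G: "\<And>f f'. (\<And>i. i \<in> K \<Longrightarrow> f i = f' i) \<Longrightarrow> G f = G f'"
  shows "measure_pmf.expectation (Pi_pmf I dflt p) (\<lambda>f. F f * G f)
    = measure_pmf.expectation (Pi_pmf I dflt p) F * measure_pmf.expectation (Pi_pmf I dflt p) G"
proof -
  define P where "P S = Pi_pmf S dflt p" for S
  have finS: "finite S" if "S \<subseteq> I" for S using that fin(1) finite_subset by blast
  have finP: "finite (set_pmf (P S))" if "S \<subseteq> I" for S
  proof -
    have "finite (PiE_dflt S dflt (set_pmf \<circ> p))"
      using that fin finS[OF that] by (intro finite_PiE_dflt) auto
    then show ?thesis using finS[OF that] by (simp add: P_def set_Pi_pmf)
  qed
  have split: "P I = map_pmf (\<lambda>(f, g) x. if x \<in> J then f x else g x) (pair_pmf (P J) (P (I - J)))"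
    using Pi_pmf_union[of J "I - J" dflt p] disj(1) finS by (simp add: P_def Un_absorb1)
  have 1: "measure_pmf.expectation (P I) F = measure_pmf.expectation (P J) F"
  proof -
    have "measure_pmf.expectation (P I) F = measure_pmf.expectation (pair_pmf (P J) (P (I - J))) (\<lambda>z. F (fst z))"
      unfolding split integral_map_pmf
      by (rule Bochner_Integration.integral_cong[OF refl]) (auto intro!: F split: prod.split)
    then show ?thesis by simp
  qed
  have 2: "measure_pmf.expectation (P I) G = measure_pmf.expectation (P (I - J)) G"
  proof -
    have "measure_pmf.expectation (P I) G = measure_pmf.expectation (pair_pmf (P J) (P (I - J))) (\<lambda>z. G (snd z))"
      unfolding split integral_map_pmf
      by (rule Bochner_Integration.integral_cong[OF refl]) (use disj in \<open>auto intro!: G split: prod.split\<close>)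
    then show ?thesis by simp
  qed
  have "measure_pmf.expectation (P I) (\<lambda>f. F f * G f)
      = measure_pmf.expectation (pair_pmf (P J) (P (I - J))) (\<lambda>(f, g). F f * G g)"
    unfolding split integral_map_pmf
    by (rule Bochner_Integration.integral_cong[OF refl])
       (use disj in \<open>auto intro!: F G arg_cong2[of _ _ _ _ "(*)"] split: prod.split\<close>)
  also have "\<dots> = measure_pmf.expectation (P J) F * measure_pmf.expectation (P (I - J)) G"
    using disj by (intro expectation_pair_pmf_mult finP) auto
  finally show ?thesis unfolding P_def[symmetric] 1 2 .
qed

lemma expectation_Pi_pmf_component:
  fixes h :: "'b \<Rightarrow> real"
  assumes "finite I" "i \<in> I"
  shows "measure_pmf.expectation (Pi_pmf I dflt p) (\<lambda>f. h (f i)) = measure_pmf.expectation (p i) h"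
proof -
  have "measure_pmf.expectation (Pi_pmf I dflt p) (\<lambda>f. h (f i))
      = measure_pmf.expectation (map_pmf (\<lambda>f. f i) (Pi_pmf I dflt p)) h"
    by simp
  also have "\<dots> = measure_pmf.expectation (p i) h"
    using assms by (subst Pi_pmf_component) auto
  finally show ?thesis .
qed

section \<open>Moments of linear forms in independent centered bounded variables\<close>

locale centered_bounded_family =
  fixes I :: "'a set" and p :: "'a \<Rightarrow> real pmf" and dflt \<rho> :: real and m :: "'a \<Rightarrow> real"
  assumes fin_I: "finite I"
    and fin_p: "\<And>i. i \<in> I \<Longrightarrow> finite (set_pmf (p i))"
    and mean: "\<And>i. i \<in> I \<Longrightarrow> measure_pmf.expectation (p i) (\<lambda>x. x) = m i"
    and bounded: "\<And>i x. i \<in> I \<Longrightarrow> x \<in> set_pmf (p i) \<Longrightarrow> \<bar>x - m i\<bar> \<le> \<rho>"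
    and \<rho>: "0 \<le> \<rho>"
begin

abbreviation E :: "(('a \<Rightarrow> real) \<Rightarrow> real) \<Rightarrow> real" where
  "E \<equiv> measure_pmf.expectation (Pi_pmf I dflt p)"

abbreviation e :: "('a \<Rightarrow> real) \<Rightarrow> 'a \<Rightarrow> real" where "e f i \<equiv> f i - m i"

lemma integrable_all: "integrable (Pi_pmf I dflt p) (F :: ('a \<Rightarrow> real) \<Rightarrow> real)"
  using integrable_Pi_pmf_finite[OF fin_I fin_p] .

lemmas E_add = Bochner_Integration.integral_add[OF integrable_all integrable_all]
lemmas E_diff = Bochner_Integration.integral_diff[OF integrable_all integrable_all]
lemmas E_sum = Bochner_Integration.integral_sum[OF integrable_all]

lemma E_mono:
  assumes "\<And>f. f \<in> set_pmf (Pi_pmf I dflt p) \<Longrightarrow> F f \<le> G f"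
  shows "E F \<le> E G"
  using assms by (intro integral_mono_AE integrable_all AE_pmfI)

lemma e_bound:
  assumes "i \<in> I" "f \<in> set_pmf (Pi_pmf I dflt p)"
  shows "\<bar>e f i\<bar> \<le> \<rho>"
  using assms bounded[OF assms(1)] by (auto simp: set_Pi_pmf fin_I PiE_dflt_def)

lemma E_e:
  assumes "i \<in> I"
  shows "E (\<lambda>f. e f i) = 0"
  using expectation_Pi_pmf_component[OF fin_I assms, of dflt p "\<lambda>x. x - m i"] assms
    integrable_measure_pmf_finite[OF fin_p[OF assms], of "\<lambda>x. x"]
  by (simp add: mean)

lemma E_mult:
  assumes "J \<subseteq> I" "K \<subseteq> I" "J \<inter> K = {}"
    and "\<And>f f'. (\<And>i. i \<in> J \<Longrightarrow> f i = f' i) \<Longrightarrow> F f = F f'"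
    and "\<And>f f'. (\<And>i. i \<in> K \<Longrightarrow> f i = f' i) \<Longrightarrow> G f = G f'"
  shows "E (\<lambda>f. F f * G f) = E F * E G"
  using expectation_Pi_pmf_mult[OF fin_I fin_p assms] .

lemma E_e_mult:
  assumes "i \<in> I" "j \<in> I"
  shows "E (\<lambda>f. e f i * e f j) = (if i = j then E (\<lambda>f. (e f i)\<^sup>2) else 0)"
  using assms E_mult[of "{i}" "{j}" "\<lambda>f. e f i" "\<lambda>f. e f j"]
  by (auto simp: E_e power2_eq_square)

text \<open>Separates a new coordinate from the linear form built so far. General exponents let this
  one rule treat every term of the binomial expansions in \<open>second_moment\<close> and
  \<open>fourth_moment\<close>.\<close>

lemma E_linear_mult:
  assumes "J \<subseteq> I" "x \<in> I" "x \<notin> J"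
  shows "E (\<lambda>f. (\<Sum>i\<in>J. a i * e f i) ^ l * e f x ^ r)
    = E (\<lambda>f. (\<Sum>i\<in>J. a i * e f i) ^ l) * E (\<lambda>f. e f x ^ r)"
proof (rule E_mult[of J "{x}"])
  fix f f' :: "'a \<Rightarrow> real" assume "\<And>i. i \<in> J \<Longrightarrow> f i = f' i"
  then show "(\<Sum>i\<in>J. a i * e f i) ^ l = (\<Sum>i\<in>J. a i * e f' i) ^ l" by simp
qed (use assms in auto)

lemma E_pow_le:
  assumes "x \<in> I"
  shows "E (\<lambda>f. e f x ^ (2 * r)) \<le> \<rho> ^ (2 * r)"
proof -
  have "E (\<lambda>f. e f x ^ (2 * r)) \<le> E (\<lambda>f. \<rho> ^ (2 * r))"
  proof (rule E_mono)
    fix f assume "f \<in> set_pmf (Pi_pmf I dflt p)"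
    then have "\<bar>e f x\<bar> ^ (2 * r) \<le> \<rho> ^ (2 * r)"
      using e_bound[OF assms] by (intro power_mono) auto
    then show "e f x ^ (2 * r) \<le> \<rho> ^ (2 * r)" by (simp add: power_even_abs)
  qed
  then show ?thesis by simp
qed

lemma second_moment:
  assumes "J \<subseteq> I"
  shows "E (\<lambda>f. (\<Sum>i\<in>J. a i * e f i)\<^sup>2) \<le> \<rho>\<^sup>2 * (\<Sum>i\<in>J. (a i)\<^sup>2)"
proof -
  have "finite J" using assms fin_I finite_subset by blast
  then show ?thesis using assms
  proof (induction J rule: finite_induct)
    case (insert x J)
    let ?S = "\<lambda>f. \<Sum>i\<in>J. a i * e f i"
    note li = E_linear_mult[of J x a, OF _ _ insert.hyps(2)]
    \<comment> \<open>The exponents 1 are kept so that the cross term matches \<open>li\<close>; it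
      vanishes because the new variable is centered.\<close>
    have pow2: "(s + a x * y)\<^sup>2 = s\<^sup>2 + 2 * a x * (s ^ 1 * y ^ 1) + (a x)\<^sup>2 * y\<^sup>2" for s y :: real
      by (simp add: power2_eq_square algebra_simps)
    have "E (\<lambda>f. (\<Sum>i\<in>insert x J. a i * e f i)\<^sup>2) = E (\<lambda>f. (?S f + a x * e f x)\<^sup>2)"
      using insert.hyps by (simp add: add.commute)
    also have "\<dots> = E (\<lambda>f. (?S f)\<^sup>2 + 2 * a x * (?S f ^ 1 * e f x ^ 1) + (a x)\<^sup>2 * (e f x)\<^sup>2)"
      by (simp only: pow2)
    also have "\<dots> = E (\<lambda>f. (?S f)\<^sup>2) + (a x)\<^sup>2 * E (\<lambda>f. (e f x)\<^sup>2)"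
      using insert.prems li[of 1 1] by (simp add: E_add E_e)
    also have "\<dots> \<le> \<rho>\<^sup>2 * (\<Sum>i\<in>J. (a i)\<^sup>2) + (a x)\<^sup>2 * \<rho>\<^sup>2"
      using insert E_pow_le[of x 1] by (intro add_mono mult_left_mono) auto
    finally show ?case using insert.hyps by (simp add: algebra_simps)
  qed simp
qed

text \<open>
  In the inductive step the odd cross terms vanish, and \<open>3 t\<^sup>2 + 6 t a\<^sup>2 + a\<^sup>4 \<le> 3 (t + a\<^sup>2)\<^sup>2\<close>.
\<close>

lemma fourth_moment:
  assumes "J \<subseteq> I"
  shows "E (\<lambda>f. (\<Sum>i\<in>J. a i * e f i) ^ 4) \<le> 3 * \<rho> ^ 4 * (\<Sum>i\<in>J. (a i)\<^sup>2)\<^sup>2"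
proof -
  have "finite J" using assms fin_I finite_subset by blast
  then show ?thesis using assms
  proof (induction J rule: finite_induct)
    case (insert x J)
    let ?S = "\<lambda>f. \<Sum>i\<in>J. a i * e f i"
    define t where "t = (\<Sum>i\<in>J. (a i)\<^sup>2)"
    have x: "x \<in> I" "J \<subseteq> I" using insert.prems by auto
    note li = E_linear_mult[of J x a, OF x(2) x(1) insert.hyps(2)]
    have t0: "0 \<le> t" by (simp add: t_def sum_nonneg)
    \<comment> \<open>Every term is brought to the shape s^l * y^r, with exponents 0 and 1 written
      out, so that \<open>li\<close> factors all of them.\<close>
    have pow4: "(s + a x * y) ^ 4 = s ^ 4 * y ^ 0 + 4 * a x * (s ^ 3 * y ^ 1) + 6 * (a x)\<^sup>2 * (s ^ 2 * y ^ 2)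
        + 4 * a x ^ 3 * (s ^ 1 * y ^ 3) + a x ^ 4 * (s ^ 0 * y ^ 4)" for s y :: real
      by (simp add: power4_eq_xxxx power3_eq_cube power2_eq_square algebra_simps)
    have S1: "E ?S = 0"
      using x(2) by (simp add: E_sum E_e subset_iff)
    have "E (\<lambda>f. (\<Sum>i\<in>insert x J. a i * e f i) ^ 4) = E (\<lambda>f. (?S f + a x * e f x) ^ 4)"
      using insert.hyps by (simp add: add.commute)
    also have "\<dots> = E (\<lambda>f. ?S f ^ 4) + 6 * (a x)\<^sup>2 * (E (\<lambda>f. (?S f)\<^sup>2) * E (\<lambda>f. (e f x)\<^sup>2))
        + a x ^ 4 * E (\<lambda>f. e f x ^ 4)"
      unfolding pow4 E_add integral_mult_right_zero li using x S1 by (simp add: E_e)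
    also have "\<dots> \<le> 3 * \<rho> ^ 4 * t\<^sup>2 + 6 * (a x)\<^sup>2 * (\<rho>\<^sup>2 * t * \<rho>\<^sup>2) + a x ^ 4 * \<rho> ^ 4"
      using insert.IH[OF x(2)] second_moment[OF x(2), of a] E_pow_le[OF x(1), of 1] E_pow_le[OF x(1), of 2] t0
      by (intro add_mono mult_left_mono mult_mono) (auto simp: t_def)
    also have "\<dots> \<le> 3 * \<rho> ^ 4 * (t + (a x)\<^sup>2)\<^sup>2"
    proof -
      have "3 * \<rho> ^ 4 * (t + (a x)\<^sup>2)\<^sup>2 - (3 * \<rho> ^ 4 * t\<^sup>2 + 6 * (a x)\<^sup>2 * (\<rho>\<^sup>2 * t * \<rho>\<^sup>2) + a x ^ 4 * \<rho> ^ 4)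
          = 2 * a x ^ 4 * \<rho> ^ 4"
        by (simp add: power4_eq_xxxx power2_eq_square algebra_simps)
      moreover have "0 \<le> 2 * a x ^ 4 * \<rho> ^ 4" by simp
      ultimately show ?thesis by linarith
    qed
    finally show ?case using insert.hyps by (simp add: t_def add.commute)
  qed simp
qed

end

section \<open>Stochastic rounding\<close>

text \<open>It suffices to exhibit one admissible cell, since \<open>LeastI\<close> passes its
  properties to the least one. In the rescaled position \<open>z\<close>, cell j covers the interval
  from j - 1 to j.\<close>

lemma grid_cell:
  assumes "0 < R" "1 \<le> B" "\<bar>x\<bar> \<le> R"
  defines "k \<equiv> grid_cell R B x"
  shows "grid_point R B k \<le> x" "x \<le> grid_point R B (k + 1)"
proof -
  define \<rho> where "\<rho> = resolution R B"
  have two: "(2::nat) ^ 1 \<le> 2 ^ B" using assms(2) by (intro power_increasing) auto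
  then have "real (2 ^ 1) \<le> real (2 ^ B)" by (intro of_nat_mono)
  then have pos: "(0::real) < 2 ^ B - 1" by simp
  then have \<rho>: "0 < \<rho>" "(2 ^ B - 1) * \<rho> = 2 * R"
    using assms(1) by (simp_all add: \<rho>_def resolution_def)
  define z where "z = (x + R) / \<rho>"
  have x: "x = - R + z * \<rho>" using \<rho>(1) by (simp add: z_def)
  have z0: "0 \<le> z" using assms(3) \<rho>(1) by (simp add: z_def)
  have "z * \<rho> \<le> (2 ^ B - 1) * \<rho>" using assms(3) x \<rho>(2) by linarith
  then have z1: "z \<le> 2 ^ B - 1" using \<rho>(1) by simp
  have gp: "grid_point R B j = - R + (real j - 1) * \<rho>" for j
    by (simp add: grid_point_def \<rho>_def)
  have "\<exists>j. 1 \<le> j \<and> j < 2 ^ B \<and> real j - 1 \<le> z \<and> z \<le> real j"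
  \<comment> \<open>At the right endpoint x = R the floor would give the index 2^B, one past the
    last cell, so cell 2^B - 1 is chosen there.\<close>
  proof (cases "z = 2 ^ B - 1")
    case True
    then show ?thesis using two by (intro exI[of _ "2 ^ B - 1"]) (auto simp: of_nat_diff)
  next
    case False
    define j where "j = nat \<lfloor>z\<rfloor> + 1"
    have j: "real j - 1 \<le> z" "z \<le> real j" using z0 unfolding j_def by linarith+
    then have "real j - 1 < 2 ^ B - 1" using z1 False by linarith
    then have "j < 2 ^ B" by simp
    then show ?thesis using j by (intro exI[of _ j]) (simp add: j_def)
  qed
  then obtain j where j: "1 \<le> j" "j < 2 ^ B" "real j - 1 \<le> z" "z \<le> real j" by blast
  have "1 \<le> k \<and> k < 2 ^ B \<and> grid_point R B k \<le> x \<and> x \<le> grid_point R B (k + 1)"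
    unfolding k_def grid_cell_def
  proof (rule LeastI[of _ j])
    show "1 \<le> j \<and> j < 2 ^ B \<and> grid_point R B j \<le> x \<and> x \<le> grid_point R B (j + 1)"
      using j \<rho>(1) unfolding gp x by (auto intro!: mult_right_mono)
  qed
  then show "grid_point R B k \<le> x" "x \<le> grid_point R B (k + 1)" by auto
qed

lemma resolution_pos:
  assumes "0 < R" "1 \<le> B"
  shows "0 < resolution R B"
proof -
  have "(2::real) ^ 1 \<le> 2 ^ B" using assms(2) by (intro power_increasing) auto
  then show ?thesis using assms(1) by (simp add: resolution_def)
qed

lemma stoch_round:
  assumes "0 < R" "1 \<le> B" "\<bar>x\<bar> \<le> R"
  shows "finite (set_pmf (stoch_round R B x))"
    and "y \<in> set_pmf (stoch_round R B x) \<Longrightarrow> \<bar>y - x\<bar> \<le> resolution R B"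
    and "measure_pmf.expectation (stoch_round R B x) (\<lambda>y. y) = x"
proof -
  define \<rho> where "\<rho> = resolution R B"
  have \<rho>: "0 < \<rho>" using resolution_pos[OF assms(1,2)] by (simp add: \<rho>_def)
  define a where "a = grid_point R B (grid_cell R B x)"
  have b: "grid_point R B (grid_cell R B x + 1) = a + \<rho>"
    by (simp add: a_def grid_point_def \<rho>_def algebra_simps)
  have ax: "a \<le> x" "x \<le> a + \<rho>" using grid_cell[OF assms] unfolding b unfolding a_def[symmetric] by auto
  define q where "q = (x - a) / \<rho>"
  have q: "0 \<le> q" "q \<le> 1" using ax \<rho> by (simp_all add: q_def)
  have sr: "stoch_round R B x = map_pmf (\<lambda>b. if b then a + \<rho> else a) (bernoulli_pmf q)"
    unfolding stoch_round_def Let_def b a_def[symmetric] q_def \<rho>_def ..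
  show "finite (set_pmf (stoch_round R B x))" unfolding sr by simp
  show "\<bar>y - x\<bar> \<le> resolution R B" if "y \<in> set_pmf (stoch_round R B x)"
    using that ax unfolding sr \<rho>_def[symmetric] by (auto split: if_splits)
  show "measure_pmf.expectation (stoch_round R B x) (\<lambda>y. y) = x"
    unfolding sr using q \<rho> by (simp add: q_def field_simps)
qed

section \<open>Moments of a noise matrix with independent entries\<close>

locale centered_bounded_matrix =
  centered_bounded_family "{..<n} \<times> {..<d}" p dflt \<rho> m
  for n d :: nat and p :: "nat \<times> nat \<Rightarrow> real pmf" and dflt \<rho> :: real and m :: "nat \<times> nat \<Rightarrow> real"
begin

abbreviation Ev :: "(nat \<times> nat \<Rightarrow> real) \<Rightarrow> (nat \<Rightarrow> real) \<Rightarrow> nat \<Rightarrow> real" where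
  "Ev f x r \<equiv> \<Sum>c<d. e f (r, c) * x c"

definition colvar :: "nat \<Rightarrow> real" where
  "colvar c = (\<Sum>r<n. E (\<lambda>f. (e f (r, c))\<^sup>2))"

text \<open>The bilinear form is linear in the noise entries with coefficients u_r y_c, whose sum of
  squares factorizes.\<close>

lemma rank_one_second_moment:
  assumes "(\<Sum>c<d. (y c)\<^sup>2) = 1"
  shows "E (\<lambda>f. (\<Sum>r<n. u r * Ev f y r)\<^sup>2) \<le> \<rho>\<^sup>2 * (\<Sum>r<n. (u r)\<^sup>2)"
proof -
  let ?a = "\<lambda>i. u (fst i) * y (snd i)"
  have "(\<Sum>r<n. u r * Ev f y r) = (\<Sum>i\<in>{..<n} \<times> {..<d}. ?a i * e f i)" for f
    by (simp add: sum_distrib_left sum.cartesian_product case_prod_beta mult_ac)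
  moreover have "(\<Sum>i\<in>{..<n} \<times> {..<d}. (?a i)\<^sup>2) = (\<Sum>r<n. (u r)\<^sup>2 * (\<Sum>c<d. (y c)\<^sup>2))"
    by (simp add: sum_distrib_left sum.cartesian_product case_prod_beta power_mult_distrib)
  ultimately show ?thesis
    using second_moment[of "{..<n} \<times> {..<d}" ?a] by (simp add: assms)
qed

lemma row_fourth_moment:
  assumes "r < n" "(\<Sum>c<d. (x c)\<^sup>2) = 1"
  shows "E (\<lambda>f. (Ev f x r) ^ 4) \<le> 3 * \<rho> ^ 4"
proof -
  have row: "(\<Sum>i\<in>{r} \<times> {..<d}. h i) = (\<Sum>c<d. h (r, c))" for h :: "nat \<times> nat \<Rightarrow> real"
  proof -
    have "{r} \<times> {..<d} = Pair r ` {..<d}" by auto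
    then show ?thesis by (simp add: sum.reindex inj_on_def)
  qed
  have "{r} \<times> {..<d} \<subseteq> {..<n} \<times> {..<d}" using assms(1) by auto
  from fourth_moment[OF this, of "\<lambda>i. x (snd i)"] show ?thesis
    unfolding row by (simp add: assms(2) mult.commute)
qed

lemma E_row_product:
  assumes "r < n"
  shows "E (\<lambda>f. Ev f x r * Ev f y r) = (\<Sum>c<d. E (\<lambda>f. (e f (r, c))\<^sup>2) * (x c * y c))"
proof -
  have "E (\<lambda>f. Ev f x r * Ev f y r)
      = E (\<lambda>f. \<Sum>c<d. \<Sum>c'<d. x c * y c' * (e f (r, c) * e f (r, c')))"
    unfolding sum_product by (simp add: mult_ac)
  also have "\<dots> = (\<Sum>c<d. \<Sum>c'<d. x c * y c' * E (\<lambda>f. e f (r, c) * e f (r, c')))"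
    by (simp add: E_sum)
  also have "\<dots> = (\<Sum>c<d. \<Sum>c'<d. if c = c' then E (\<lambda>f. (e f (r, c))\<^sup>2) * (x c * y c') else 0)"
    using assms by (intro sum.cong refl) (auto simp: E_e_mult)
  finally show ?thesis by simp
qed

text \<open>
  The rows of the noise are independent, so the fluctuations of the quadratic chaos add up
  orthogonally over the rows.
\<close>

lemma chaos_second_moment:
  assumes "(\<Sum>c<d. (x c)\<^sup>2) = 1" "(\<Sum>c<d. (y c)\<^sup>2) = 1"
  shows "E (\<lambda>f. (\<Sum>r<n. Ev f x r * Ev f y r)\<^sup>2)
    \<le> (\<Sum>c<d. colvar c * x c * y c)\<^sup>2 + 3 * \<rho> ^ 4 * real n"
proof -
  define Z where "Z r f = Ev f x r * Ev f y r" for r f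
  define \<mu> where "\<mu> r = E (Z r)" for r
  define W where "W r f = Z r f - \<mu> r" for r f
  have "(\<Sum>r<n. \<mu> r) = (\<Sum>r<n. \<Sum>c<d. E (\<lambda>f. (e f (r, c))\<^sup>2) * (x c * y c))"
    unfolding \<mu>_def Z_def by (intro sum.cong refl E_row_product) auto
  also have "\<dots> = (\<Sum>c<d. colvar c * x c * y c)"
    unfolding colvar_def by (subst sum.swap) (simp add: sum_distrib_right mult.assoc)
  finally have \<mu>: "(\<Sum>r<n. \<mu> r) = (\<Sum>c<d. colvar c * x c * y c)" .
  have EW: "E (W r) = 0" for r
    unfolding W_def by (subst E_diff) (simp add: \<mu>_def)
  have WW: "E (\<lambda>f. W r f * W r' f) = (if r = r' then E (\<lambda>f. (W r f)\<^sup>2) else 0)"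
    if "r < n" "r' < n" for r r'
  proof (cases "r = r'")
    case False
    have "E (\<lambda>f. W r f * W r' f) = E (W r) * E (W r')"
    proof (rule E_mult[of "{r} \<times> {..<d}" "{r'} \<times> {..<d}"])
      fix f f' :: "nat \<times> nat \<Rightarrow> real"
      show "W r f = W r f'" if "\<And>i. i \<in> {r} \<times> {..<d} \<Longrightarrow> f i = f' i"
        unfolding W_def Z_def using that by simp
      show "W r' f = W r' f'" if "\<And>i. i \<in> {r'} \<times> {..<d} \<Longrightarrow> f i = f' i"
        unfolding W_def Z_def using that by simp
    qed (use that False in auto)
    then show ?thesis using False by (simp add: EW)
  qed (simp add: power2_eq_square)
  have W2: "E (\<lambda>f. (W r f)\<^sup>2) \<le> 3 * \<rho> ^ 4" if "r < n" for r
  proof -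
    have "(W r f)\<^sup>2 = (Z r f)\<^sup>2 - 2 * \<mu> r * Z r f + (\<mu> r)\<^sup>2" for f
      by (simp add: W_def power2_diff)
    then have "E (\<lambda>f. (W r f)\<^sup>2) = E (\<lambda>f. (Z r f)\<^sup>2) - (\<mu> r)\<^sup>2"
      by (simp add: E_add E_diff \<mu>_def power2_eq_square)
    also have "\<dots> \<le> E (\<lambda>f. (Z r f)\<^sup>2)" by simp
    \<comment> \<open>The two factors of \<open>Z r\<close> come from the same row and are
      dependent; the inequality s^2 t^2 <= (s^4 + t^4)/2 reduces to fourth moments in a single
      direction.\<close>
    also have "\<dots> \<le> E (\<lambda>f. (Ev f x r ^ 4 + Ev f y r ^ 4) / 2)"
    proof (rule E_mono)
      fix f
      have "s\<^sup>2 * t\<^sup>2 \<le> (s ^ 4 + t ^ 4) / 2" for s t :: real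
        using sum_squares_bound[of "s\<^sup>2" "t\<^sup>2"] by (simp flip: power_mult)
      then show "(Z r f)\<^sup>2 \<le> (Ev f x r ^ 4 + Ev f y r ^ 4) / 2"
        unfolding Z_def power_mult_distrib .
    qed
    also have "\<dots> = (E (\<lambda>f. Ev f x r ^ 4) + E (\<lambda>f. Ev f y r ^ 4)) / 2"
      by (simp add: E_add)
    also have "\<dots> \<le> 3 * \<rho> ^ 4"
      using row_fourth_moment[OF that assms(1)] row_fourth_moment[OF that assms(2)] by simp
    finally show ?thesis .
  qed
  have EW2: "E (\<lambda>f. (\<Sum>r<n. W r f)\<^sup>2) \<le> 3 * \<rho> ^ 4 * real n"
  proof -
    have "E (\<lambda>f. (\<Sum>r<n. W r f)\<^sup>2) = (\<Sum>r<n. \<Sum>r'<n. E (\<lambda>f. W r f * W r' f))"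
      unfolding power2_eq_square sum_product by (simp add: E_sum)
    also have "\<dots> = (\<Sum>r<n. \<Sum>r'<n. if r = r' then E (\<lambda>f. (W r f)\<^sup>2) else 0)"
      by (intro sum.cong refl) (auto simp: WW)
    also have "\<dots> = (\<Sum>r<n. E (\<lambda>f. (W r f)\<^sup>2))" by simp
    also have "\<dots> \<le> (\<Sum>r<n. 3 * \<rho> ^ 4)" by (intro sum_mono W2) auto
    finally show ?thesis by (simp add: mult.commute)
  qed
  define M where "M = (\<Sum>r<n. \<mu> r)"
  have "E (\<lambda>f. (\<Sum>r<n. Z r f)\<^sup>2) = E (\<lambda>f. M\<^sup>2 + 2 * M * (\<Sum>r<n. W r f) + (\<Sum>r<n. W r f)\<^sup>2)"
    by (intro arg_cong[of _ _ E] ext) (simp add: W_def M_def sum_subtractf power2_diff algebra_simps power2_eq_square)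
  also have "\<dots> = M\<^sup>2 + E (\<lambda>f. (\<Sum>r<n. W r f)\<^sup>2)"
    by (simp add: E_add E_sum EW)
  finally show ?thesis
    using EW2 unfolding Z_def M_def \<mu> by simp
qed

text \<open>Prepared for one entry of the Gram perturbation in an eigenbasis, with \<open>u\<close>
  and \<open>w\<close> the images under A of the two basis vectors: two terms linear in the noise
  and one quadratic chaos. The factor 3 comes from squaring a sum of three terms.\<close>

lemma gram_perturbation_entry_second_moment:
  assumes "(\<Sum>c<d. (x c)\<^sup>2) = 1" "(\<Sum>c<d. (y c)\<^sup>2) = 1"
  shows "E (\<lambda>f. (\<Sum>r<n. u r * Ev f y r + w r * Ev f x r + Ev f x r * Ev f y r)\<^sup>2)
    \<le> 3 * (\<rho>\<^sup>2 * ((\<Sum>r<n. (u r)\<^sup>2) + (\<Sum>r<n. (w r)\<^sup>2))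
        + (\<Sum>c<d. colvar c * x c * y c)\<^sup>2 + 3 * \<rho> ^ 4 * real n)"
proof -
  have sq3: "(a + b + c)\<^sup>2 \<le> 3 * (a\<^sup>2 + b\<^sup>2 + c\<^sup>2)" for a b c :: real
    using sum_squares_bound[of a b] sum_squares_bound[of a c] sum_squares_bound[of b c]
    by (simp add: power2_eq_square algebra_simps)
  have "E (\<lambda>f. (\<Sum>r<n. u r * Ev f y r + w r * Ev f x r + Ev f x r * Ev f y r)\<^sup>2)
    \<le> E (\<lambda>f. 3 * ((\<Sum>r<n. u r * Ev f y r)\<^sup>2 + (\<Sum>r<n. w r * Ev f x r)\<^sup>2
        + (\<Sum>r<n. Ev f x r * Ev f y r)\<^sup>2))"
    unfolding sum.distrib by (intro E_mono sq3)
  also have "\<dots> = 3 * (E (\<lambda>f. (\<Sum>r<n. u r * Ev f y r)\<^sup>2) + E (\<lambda>f. (\<Sum>r<n. w r * Ev f x r)\<^sup>2)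
        + E (\<lambda>f. (\<Sum>r<n. Ev f x r * Ev f y r)\<^sup>2))"
    by (simp add: E_add)
  finally show ?thesis
    using rank_one_second_moment[OF assms(2), of u] rank_one_second_moment[OF assms(1), of w]
      chaos_second_moment[OF assms] by (simp add: distrib_left)
qed

end

section \<open>Perturbation of a Gram matrix\<close>

lemma gram_basis_exists:
  assumes "A \<in> carrier_mat n d"
  obtains v where "gram_basis A n d v"
  by (rule gram_eigenbasis[OF assms]) (rule that)

lemma singular_value_antimono:
  assumes "A \<in> carrier_mat n d" "a \<le> b" "b < d"
  shows "(singular_value (Suc b) A)\<^sup>2 \<le> (singular_value (Suc a) A)\<^sup>2"
  by (rule gram_eigenbasis[OF assms(1)]) (use assms in blast)

lemma singular_value_nonneg:
  assumes "A \<in> carrier_mat n d" "a < d"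
  shows "0 \<le> singular_value (Suc a) A"
  by (rule gram_eigenbasis[OF assms(1)]) (use assms in blast)

lemma orthonormal_expansion:
  fixes v :: "nat \<Rightarrow> nat \<Rightarrow> real"
  assumes "\<And>i j. i < d \<Longrightarrow> j < d \<Longrightarrow> (\<Sum>a<d. v a i * v a j) = (if i = j then 1 else 0)" "b < d"
  shows "(\<Sum>a<d. (\<Sum>i<d. x i * v a i) * v a b) = x b"
proof -
  have "(\<Sum>a<d. (\<Sum>i<d. x i * v a i) * v a b) = (\<Sum>i<d. x i * (\<Sum>a<d. v a i * v a b))"
    unfolding sum_distrib_left sum_distrib_right by (subst sum.swap) (simp add: mult.assoc)
  also have "\<dots> = (\<Sum>i<d. if i = b then x i else 0)"
    using assms by (intro sum.cong refl) auto
  finally show ?thesis using assms(2) by simp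
qed

lemma parseval:
  fixes v :: "nat \<Rightarrow> nat \<Rightarrow> real"
  assumes "\<And>i j. i < d \<Longrightarrow> j < d \<Longrightarrow> (\<Sum>a<d. v a i * v a j) = (if i = j then 1 else 0)"
  shows "(\<Sum>a<d. (\<Sum>i<d. x i * v a i) * (\<Sum>i<d. y i * v a i)) = (\<Sum>i<d. x i * y i)"
proof -
  have "(\<Sum>a<d. (\<Sum>i<d. x i * v a i) * (\<Sum>j<d. y j * v a j))
      = (\<Sum>a<d. \<Sum>j<d. (\<Sum>i<d. x i * v a i) * v a j * y j)"
    unfolding sum_distrib_left by (simp add: mult_ac)
  also have "\<dots> = (\<Sum>j<d. (\<Sum>a<d. (\<Sum>i<d. x i * v a i) * v a j) * y j)"
    by (subst sum.swap) (simp add: sum_distrib_right)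
  also have "\<dots> = (\<Sum>j<d. x j * y j)"
    using assms by (intro sum.cong refl) (simp add: orthonormal_expansion)
  finally show ?thesis .
qed

text \<open>The trace identity: Parseval applied to each row of \<open>A\<close>, whose coefficients
  in the singular basis are the values \<open>mv A d (v a) r\<close>.\<close>

lemma sum_singular_values_squared:
  assumes "A \<in> carrier_mat n d"
  shows "(\<Sum>a<d. (singular_value (Suc a) A)\<^sup>2) = (\<Sum>r<n. \<Sum>c<d. (A $$ (r, c))\<^sup>2)"
proof -
  obtain v where v: "gram_basis A n d v" using gram_basis_exists[OF assms] .
  then have "(\<Sum>a<d. (singular_value (Suc a) A)\<^sup>2) = (\<Sum>a<d. \<Sum>r<n. mv A d (v a) r * mv A d (v a) r)"
    unfolding gram_basis_def by (intro sum.cong refl) auto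
  also have "\<dots> = (\<Sum>r<n. \<Sum>a<d. mv A d (v a) r * mv A d (v a) r)"
    by (rule sum.swap)
  also have "\<dots> = (\<Sum>r<n. \<Sum>c<d. (A $$ (r, c))\<^sup>2)"
    using v unfolding gram_basis_def power2_eq_square by (intro sum.cong refl parseval) auto
  finally show ?thesis .
qed

lemma mv_combination:
  "mv A d (\<lambda>b. \<Sum>i<d. x i * v i b) r = (\<Sum>i<d. x i * mv A d (v i) r)"
  unfolding sum_distrib_left by (subst sum.swap) (simp add: mult_ac)

lemma sum_square_combination:
  fixes f :: "nat \<Rightarrow> nat \<Rightarrow> real"
  shows "(\<Sum>r<n. (\<Sum>i<d. x i * f i r)\<^sup>2) = (\<Sum>i<d. \<Sum>j<d. x i * x j * (\<Sum>r<n. f i r * f j r))"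
proof -
  have "(\<Sum>r<n. (\<Sum>i<d. x i * f i r)\<^sup>2) = (\<Sum>r<n. \<Sum>i<d. \<Sum>j<d. x i * x j * (f i r * f j r))"
    unfolding power2_eq_square sum_product by (simp add: mult_ac)
  also have "\<dots> = (\<Sum>i<d. \<Sum>j<d. x i * x j * (\<Sum>r<n. f i r * f j r))"
    unfolding sum_distrib_left by (rule sum_swap3)
  finally show ?thesis .
qed

text \<open>In the singular basis the form is diagonal, and its largest coefficient is the first
  one.\<close>

lemma mv_norm_le:
  assumes A: "A \<in> carrier_mat n d" and "0 < d"
  shows "(\<Sum>r<n. (mv A d x r)\<^sup>2) \<le> (singular_value 1 A)\<^sup>2 * (\<Sum>c<d. (x c)\<^sup>2)"
proof -
  obtain v where v: "gram_basis A n d v" using gram_basis_exists[OF A] .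
  then have cols: "\<And>i j. i < d \<Longrightarrow> j < d \<Longrightarrow> (\<Sum>a<d. v a i * v a j) = (if i = j then 1 else 0)"
    and gram: "\<And>a b. a < d \<Longrightarrow> b < d \<Longrightarrow> (\<Sum>r<n. mv A d (v a) r * mv A d (v b) r)
        = (if a = b then (singular_value (Suc a) A)\<^sup>2 else 0)"
    by (auto simp: gram_basis_def)
  define y where "y a = (\<Sum>i<d. x i * v a i)" for a
  have "mv A d x r = (\<Sum>i<d. y i * mv A d (v i) r)" for r
    unfolding mv_combination[symmetric] y_def
    by (intro sum.cong refl) (simp add: orthonormal_expansion cols)
  then have "(\<Sum>r<n. (mv A d x r)\<^sup>2) = (\<Sum>i<d. \<Sum>j<d. y i * y j * (\<Sum>r<n. mv A d (v i) r * mv A d (v j) r))"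
    by (simp only: sum_square_combination)
  also have "\<dots> = (\<Sum>i<d. \<Sum>j<d. if i = j then (y i)\<^sup>2 * (singular_value (Suc i) A)\<^sup>2 else 0)"
    by (intro sum.cong refl) (auto simp: gram power2_eq_square)
  also have "\<dots> \<le> (\<Sum>i<d. (y i)\<^sup>2 * (singular_value 1 A)\<^sup>2)"
    using singular_value_antimono[OF A, of 0]
    by (simp, intro sum_mono mult_left_mono) auto
  also have "\<dots> = (singular_value 1 A)\<^sup>2 * (\<Sum>i<d. (y i)\<^sup>2)"
    by (simp add: sum_distrib_left mult.commute)
  also have "(\<Sum>i<d. (y i)\<^sup>2) = (\<Sum>i<d. (x i)\<^sup>2)"
    unfolding y_def power2_eq_square by (rule parseval[OF cols])
  finally show ?thesis .
qed

text \<open>Entry (i, j) of the perturbation of the Gram matrix, written in the basis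
  \<open>v\<close>.\<close>

definition gram_diff :: "real mat \<Rightarrow> real mat \<Rightarrow> nat \<Rightarrow> nat \<Rightarrow> (nat \<Rightarrow> nat \<Rightarrow> real) \<Rightarrow> nat \<Rightarrow> nat \<Rightarrow> real" where
  "gram_diff A A' n d v i j =
     (\<Sum>r<n. mv A' d (v i) r * mv A' d (v j) r) - (\<Sum>r<n. mv A d (v i) r * mv A d (v j) r)"

text \<open>Instantiates the abstract perturbation setting with the inner products of the two
  singular bases as coefficients. Only a bound on the quadratic form is assumed, so the likely event
  and the worst case can both supply their own \<delta>.\<close>

lemma perturbed_eigenbasis_gram:
  assumes A: "A \<in> carrier_mat n d" and k: "1 \<le> k" "k < d"
    and v: "gram_basis A n d v" and w: "gram_basis A' n d w"
    and form: "\<And>x. \<bar>(\<Sum>r<n. (mv A' d x r)\<^sup>2) - (\<Sum>r<n. (mv A d x r)\<^sup>2)\<bar> \<le> \<delta> * (\<Sum>c<d. (x c)\<^sup>2)"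
  shows "perturbed_eigenbasis d k (\<lambda>a i. \<Sum>b<d. w a b * v i b) (gram_diff A A' n d v)
    (\<lambda>i. (singular_value (Suc i) A)\<^sup>2) (\<lambda>a. (singular_value (Suc a) A')\<^sup>2)
    ((singular_value k A)\<^sup>2 - (singular_value (k + 1) A)\<^sup>2) \<delta>"
proof
  define c where "c a i = (\<Sum>b<d. w a b * v i b)" for a i
  let ?D = "gram_diff A A' n d v"
  have vr: "\<And>a b. a < d \<Longrightarrow> b < d \<Longrightarrow> (\<Sum>i<d. v a i * v b i) = (if a = b then 1 else 0)"
    and vc: "\<And>i j. i < d \<Longrightarrow> j < d \<Longrightarrow> (\<Sum>a<d. v a i * v a j) = (if i = j then 1 else 0)"
    and vg: "\<And>a b. a < d \<Longrightarrow> b < d \<Longrightarrow> (\<Sum>r<n. mv A d (v a) r * mv A d (v b) r)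
        = (if a = b then (singular_value (Suc a) A)\<^sup>2 else 0)"
    using v by (auto simp: gram_basis_def)
  have wr: "\<And>a b. a < d \<Longrightarrow> b < d \<Longrightarrow> (\<Sum>i<d. w a i * w b i) = (if a = b then 1 else 0)"
    and wc: "\<And>i j. i < d \<Longrightarrow> j < d \<Longrightarrow> (\<Sum>a<d. w a i * w a j) = (if i = j then 1 else 0)"
    and wg: "\<And>a b. a < d \<Longrightarrow> b < d \<Longrightarrow> (\<Sum>r<n. mv A' d (w a) r * mv A' d (w b) r)
        = (if a = b then (singular_value (Suc a) A')\<^sup>2 else 0)"
    using w by (auto simp: gram_basis_def)
  show "k \<le> d" using k by simp
  show "(\<Sum>i<d. (\<Sum>b<d. w a b * v i b) * (\<Sum>b<d. w a' b * v i b)) = (if a = a' then 1 else 0)"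
    if "a < d" "a' < d" for a a'
    using parseval[OF vc, where x = "w a" and y = "w a'"] wr[OF that] by simp
  show "(\<Sum>a<d. (\<Sum>b<d. w a b * v i b) * (\<Sum>b<d. w a b * v j b)) = (if i = j then 1 else 0)"
    if "i < d" "j < d" for i j
    using parseval[OF wc, where x = "v i" and y = "v j"] vr[OF that] by (simp add: mult.commute)
  show "?D i j = ?D j i" if "i < d" "j < d" for i j
    by (simp add: gram_diff_def mult.commute)
  have form_D: "(\<Sum>r<n. (mv A' d (\<lambda>b. \<Sum>i<d. x i * v i b) r)\<^sup>2) - (\<Sum>r<n. (mv A d (\<lambda>b. \<Sum>i<d. x i * v i b) r)\<^sup>2)
      = (\<Sum>i<d. \<Sum>j<d. x i * x j * ?D i j)" for x
    unfolding mv_combination sum_square_combination gram_diff_def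
    by (simp add: right_diff_distrib sum_subtractf)
  show "(singular_value (Suc a) A')\<^sup>2 = (\<Sum>i<d. (singular_value (Suc i) A)\<^sup>2 * (\<Sum>b<d. w a b * v i b)\<^sup>2)
      + (\<Sum>i<d. \<Sum>j<d. (\<Sum>b<d. w a b * v i b) * (\<Sum>b<d. w a b * v j b) * ?D i j)" if a: "a < d" for a
  proof -
    \<comment> \<open>Expands the perturbed vector \<open>w a\<close> in the unperturbed
      basis.\<close>
    have exp: "mv M d (\<lambda>b. \<Sum>i<d. c a i * v i b) r = mv M d (w a) r" for M r
      unfolding c_def by (intro sum.cong refl) (simp add: orthonormal_expansion vc)
    have "(\<Sum>r<n. (mv A d (w a) r)\<^sup>2) = (\<Sum>i<d. \<Sum>j<d. c a i * c a j * (\<Sum>r<n. mv A d (v i) r * mv A d (v j) r))"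
      unfolding exp[symmetric] mv_combination sum_square_combination ..
    also have "\<dots> = (\<Sum>i<d. \<Sum>j<d. if i = j then (singular_value (Suc i) A)\<^sup>2 * (c a i)\<^sup>2 else 0)"
      by (intro sum.cong refl) (auto simp: vg power2_eq_square)
    finally have "(\<Sum>r<n. (mv A d (w a) r)\<^sup>2) = (\<Sum>i<d. (singular_value (Suc i) A)\<^sup>2 * (c a i)\<^sup>2)"
      by simp
    moreover have "(\<Sum>r<n. (mv A' d (w a) r)\<^sup>2) = (singular_value (Suc a) A')\<^sup>2"
      using wg[OF a a] by (simp add: power2_eq_square)
    ultimately have "(singular_value (Suc a) A')\<^sup>2 = (\<Sum>i<d. (singular_value (Suc i) A)\<^sup>2 * (c a i)\<^sup>2)
      + (\<Sum>i<d. \<Sum>j<d. c a i * c a j * ?D i j)"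
      using form_D[of "c a"] unfolding exp by linarith
    then show ?thesis unfolding c_def .
  qed
  show "\<bar>\<Sum>i<d. \<Sum>j<d. x i * x j * ?D i j\<bar> \<le> \<delta> * (\<Sum>i<d. (x i)\<^sup>2)" for x
  proof -
    have "(\<Sum>b<d. (\<Sum>i<d. x i * v i b)\<^sup>2) = (\<Sum>i<d. (x i)\<^sup>2)"
      unfolding power2_eq_square by (rule parseval[where v = "\<lambda>b i. v i b"]) (rule vr)
    then show ?thesis using form[of "\<lambda>b. \<Sum>i<d. x i * v i b"] unfolding form_D by simp
  qed
  show "(singular_value (Suc j) A)\<^sup>2 + ((singular_value k A)\<^sup>2 - (singular_value (k + 1) A)\<^sup>2)
      \<le> (singular_value (Suc i) A)\<^sup>2" if "i < k" "k \<le> j" "j < d" for i j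
  proof -
    \<comment> \<open>Position k - 1 counted from 0 holds the k-th singular value, so antitonicity
      extends the gap to every pair across the cut.\<close>
    have "i \<le> k - 1" "k - 1 < d" using that k by auto
    then show ?thesis
      using singular_value_antimono[OF A, of i "k - 1"] singular_value_antimono[OF A, of k j] that k
      by simp
  qed
qed

section \<open>Bounds on the quadratic form of the Gram perturbation\<close>

lemma Cauchy_Schwarz_sqrt:
  fixes f g :: "'a \<Rightarrow> real"
  shows "\<bar>\<Sum>i\<in>I. f i * g i\<bar> \<le> sqrt (\<Sum>i\<in>I. (f i)\<^sup>2) * sqrt (\<Sum>i\<in>I. (g i)\<^sup>2)"
  using real_sqrt_le_mono[OF Cauchy_Schwarz_ineq_sum[of f g I]] by (simp add: real_sqrt_mult)

lemma spectral_norm_form: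
  assumes M: "M \<in> carrier_mat d d"
  shows "\<bar>\<Sum>i<d. \<Sum>j<d. x i * x j * M $$ (i, j)\<bar> \<le> spectral_norm M * (\<Sum>i<d. (x i)\<^sup>2)"
proof (cases "(\<Sum>i<d. (x i)\<^sup>2) = 0")
  case True
  then have "\<forall>i<d. x i = 0" by (simp add: sum_nonneg_eq_0_iff)
  then show ?thesis using True by simp
next
  case False
  define s where "s = sqrt (\<Sum>i<d. (x i)\<^sup>2)"
  have s2: "s\<^sup>2 = (\<Sum>i<d. (x i)\<^sup>2)" by (simp add: s_def sum_nonneg)
  have s: "0 < s"
    using False sum_nonneg[of "{..<d}" "\<lambda>i. (x i)\<^sup>2"] by (simp add: s_def)
  have norm_sum: "euclidean_norm (Matrix.vec d f) = sqrt (\<Sum>i<d. (f i)\<^sup>2)" for f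
    by (simp add: euclidean_norm_def scalar_prod_def atLeast0LessThan power2_eq_square)
  have norm_M: "euclidean_norm (M *\<^sub>v Matrix.vec d f) = sqrt (\<Sum>i<d. (\<Sum>j<d. M $$ (i, j) * f j)\<^sup>2)" for f
    using M by (simp add: euclidean_norm_def scalar_prod_def atLeast0LessThan power2_eq_square)
  define S where "S = {v \<in> carrier_vec (dim_col M). euclidean_norm v = 1}"
  \<comment> \<open>The supremum dominates its members only for a set bounded above; the Frobenius
    norm is such a bound.\<close>
  have bdd: "bdd_above ((\<lambda>v. euclidean_norm (M *\<^sub>v v)) ` S)"
  proof (rule bdd_aboveI2)
    fix v assume v: "v \<in> S"
    define f where "f i = v $ i" for i
    have vf: "v = Matrix.vec d f" using v M by (auto simp: S_def f_def)
    have "euclidean_norm v = 1" using v by (simp add: S_def)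
    then have "euclidean_norm (Matrix.vec d f) = 1" by (simp only: vf[symmetric])
    then have f1: "(\<Sum>i<d. (f i)\<^sup>2) = 1" unfolding norm_sum by simp
    have "(\<Sum>i<d. (\<Sum>j<d. M $$ (i, j) * f j)\<^sup>2) \<le> (\<Sum>i<d. (\<Sum>j<d. (M $$ (i, j))\<^sup>2) * (\<Sum>j<d. (f j)\<^sup>2))"
      by (intro sum_mono Cauchy_Schwarz_ineq_sum)
    then show "euclidean_norm (M *\<^sub>v v) \<le> sqrt (\<Sum>i<d. \<Sum>j<d. (M $$ (i, j))\<^sup>2)"
      unfolding vf norm_M by (simp add: f1)
  qed
  define f where "f i = x i / s" for i
  have f1: "(\<Sum>i<d. (f i)\<^sup>2) = 1"
    using False by (simp add: f_def power_divide s2 flip: sum_divide_distrib)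
  have "Matrix.vec d f \<in> S" using M by (simp add: S_def norm_sum f1)
  then have "euclidean_norm (M *\<^sub>v Matrix.vec d f) \<le> spectral_norm M"
    unfolding spectral_norm_def S_def[symmetric] by (rule cSUP_upper[OF _ bdd])
  then have sn: "sqrt (\<Sum>i<d. (\<Sum>j<d. M $$ (i, j) * f j)\<^sup>2) \<le> spectral_norm M"
    unfolding norm_M .
  have "\<bar>\<Sum>i<d. f i * (\<Sum>j<d. M $$ (i, j) * f j)\<bar>
      \<le> sqrt (\<Sum>i<d. (f i)\<^sup>2) * sqrt (\<Sum>i<d. (\<Sum>j<d. M $$ (i, j) * f j)\<^sup>2)"
    by (rule Cauchy_Schwarz_sqrt)
  then have f_form: "\<bar>\<Sum>i<d. f i * (\<Sum>j<d. M $$ (i, j) * f j)\<bar> \<le> spectral_norm M"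
    using sn f1 by simp
  have "x i = s * f i" for i using s by (simp add: f_def)
  then have "(\<Sum>i<d. \<Sum>j<d. x i * x j * M $$ (i, j)) = s\<^sup>2 * (\<Sum>i<d. f i * (\<Sum>j<d. M $$ (i, j) * f j))"
    by (simp add: sum_distrib_left power2_eq_square mult_ac)
  then have "\<bar>\<Sum>i<d. \<Sum>j<d. x i * x j * M $$ (i, j)\<bar> \<le> s\<^sup>2 * spectral_norm M"
    using f_form by (simp add: abs_mult mult_left_mono)
  then show ?thesis by (simp add: s2 mult.commute)
qed

lemma gram_form_spectral:
  assumes A: "A \<in> carrier_mat n d" and A': "A' \<in> carrier_mat n d"
  shows "\<bar>(\<Sum>r<n. (mv A' d x r)\<^sup>2) - (\<Sum>r<n. (mv A d x r)\<^sup>2)\<bar>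
    \<le> spectral_norm (transpose_mat A' * A' - transpose_mat A * A) * (\<Sum>c<d. (x c)\<^sup>2)"
proof -
  define M where "M = transpose_mat A' * A' - transpose_mat A * A"
  have "transpose_mat A * A \<in> carrier_mat d d" using A by simp
  then have M: "M \<in> carrier_mat d d" unfolding M_def by (rule minus_carrier_mat)
  have gram: "(\<Sum>r<n. (mv N d x r)\<^sup>2) = (\<Sum>i<d. \<Sum>j<d. x i * x j * (\<Sum>r<n. N $$ (r, i) * N $$ (r, j)))"
    for N :: "real mat"
    using sum_square_combination[where x = x and f = "\<lambda>i r. N $$ (r, i)"] by (simp add: mult.commute)
  have M_entry: "M $$ (i, j) = (\<Sum>r<n. A' $$ (r, i) * A' $$ (r, j)) - (\<Sum>r<n. A $$ (r, i) * A $$ (r, j))"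
    if "i < d" "j < d" for i j
    using A A' that by (simp add: M_def scalar_prod_def atLeast0LessThan)
  have "(\<Sum>r<n. (mv A' d x r)\<^sup>2) - (\<Sum>r<n. (mv A d x r)\<^sup>2) = (\<Sum>i<d. \<Sum>j<d. x i * x j * M $$ (i, j))"
    unfolding gram sum_subtractf[symmetric] right_diff_distrib[symmetric]
    by (intro sum.cong refl) (simp add: M_entry sum_subtractf)
  then show ?thesis using spectral_norm_form[OF M, of x] by (simp add: M_def)
qed

text \<open>The worst case that defines \<beta>. With \<epsilon> the noise applied to x, the
  difference is 2<Ax, \<epsilon>> + |\<epsilon>|^2, and entrywise boundedness gives |\<epsilon>|^2
  <= \<rho>^2 n d |x|^2 by Cauchy-Schwarz in each row.\<close>

lemma gram_form_bounded_noise: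
  assumes A: "A \<in> carrier_mat n d" and d: "0 < d" and \<rho>: "0 \<le> \<rho>"
    and noise: "\<And>r c. r < n \<Longrightarrow> c < d \<Longrightarrow> \<bar>A' $$ (r, c) - A $$ (r, c)\<bar> \<le> \<rho>"
  shows "\<bar>(\<Sum>r<n. (mv A' d x r)\<^sup>2) - (\<Sum>r<n. (mv A d x r)\<^sup>2)\<bar>
    \<le> (2 * singular_value 1 A * \<rho> * sqrt (real n * real d) + \<rho>\<^sup>2 * real n * real d) * (\<Sum>c<d. (x c)\<^sup>2)"
proof -
  define \<epsilon> where "\<epsilon> r = mv A' d x r - mv A d x r" for r
  define X where "X = (\<Sum>c<d. (x c)\<^sup>2)"
  define \<sigma> where "\<sigma> = singular_value 1 A"
  have X: "0 \<le> X" by (simp add: X_def sum_nonneg)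
  have \<sigma>: "0 \<le> \<sigma>" using singular_value_nonneg[OF A d] by (simp add: \<sigma>_def)
  have "(\<epsilon> r)\<^sup>2 \<le> real d * \<rho>\<^sup>2 * X" if "r < n" for r
  proof -
    have "\<epsilon> r = (\<Sum>c<d. (A' $$ (r, c) - A $$ (r, c)) * x c)"
      by (simp add: \<epsilon>_def left_diff_distrib sum_subtractf)
    then have "(\<epsilon> r)\<^sup>2 \<le> (\<Sum>c<d. (A' $$ (r, c) - A $$ (r, c))\<^sup>2) * X"
      unfolding X_def by (simp only: Cauchy_Schwarz_ineq_sum)
    also have "(\<Sum>c<d. (A' $$ (r, c) - A $$ (r, c))\<^sup>2) \<le> (\<Sum>c<d. \<rho>\<^sup>2)"
      using noise[OF that] \<rho> by (intro sum_mono) (simp add: power2_le_iff_abs_le)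
    finally show ?thesis using X by (simp add: mult_right_mono)
  qed
  then have "(\<Sum>r<n. (\<epsilon> r)\<^sup>2) \<le> (\<Sum>r<n. real d * \<rho>\<^sup>2 * X)" by (intro sum_mono) auto
  then have \<epsilon>: "(\<Sum>r<n. (\<epsilon> r)\<^sup>2) \<le> \<rho>\<^sup>2 * real n * real d * X" by (simp add: mult_ac)
  have "\<bar>\<Sum>r<n. mv A d x r * \<epsilon> r\<bar> \<le> sqrt (\<Sum>r<n. (mv A d x r)\<^sup>2) * sqrt (\<Sum>r<n. (\<epsilon> r)\<^sup>2)"
    by (rule Cauchy_Schwarz_sqrt)
  also have "\<dots> \<le> sqrt (\<sigma>\<^sup>2 * X) * sqrt (\<rho>\<^sup>2 * real n * real d * X)"
    using mv_norm_le[OF A d, of x] \<epsilon> by (intro mult_mono) (auto simp: \<sigma>_def X_def sum_nonneg)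
  also have "\<dots> = \<sigma> * \<rho> * sqrt (real n * real d) * X"
    using \<sigma> \<rho> X by (simp add: real_sqrt_mult mult_ac)
  finally have cross: "\<bar>\<Sum>r<n. mv A d x r * \<epsilon> r\<bar> \<le> \<sigma> * \<rho> * sqrt (real n * real d) * X" .
  have "(mv A' d x r)\<^sup>2 = (mv A d x r)\<^sup>2 + 2 * (mv A d x r * \<epsilon> r) + (\<epsilon> r)\<^sup>2" for r
    by (simp add: \<epsilon>_def power2_eq_square algebra_simps)
  then have "(\<Sum>r<n. (mv A' d x r)\<^sup>2) - (\<Sum>r<n. (mv A d x r)\<^sup>2)
      = 2 * (\<Sum>r<n. mv A d x r * \<epsilon> r) + (\<Sum>r<n. (\<epsilon> r)\<^sup>2)"
    by (simp only: sum.distrib sum_distrib_left[symmetric])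
  also have "\<bar>\<dots>\<bar> \<le> 2 * (\<sigma> * \<rho> * sqrt (real n * real d) * X) + \<rho>\<^sup>2 * real n * real d * X"
  proof -
    have "0 \<le> (\<Sum>r<n. (\<epsilon> r)\<^sup>2)" by (simp add: sum_nonneg)
    then show ?thesis using cross \<epsilon> by linarith
  qed
  finally show ?thesis unfolding X_def[symmetric] \<sigma>_def[symmetric] by (simp add: algebra_simps)
qed

section \<open>Expected excess tail energy\<close>

text \<open>For t <= 1/2 the quadratic bound is available. For larger t, 1 <= 4t^2 turns the linear
  crude bound into the cubic one: t <= 4t^3 <= 4t^3/(1 - t).\<close>

lemma cubic_remainder:
  fixes X q g t \<kappa> :: real
  assumes "0 < g" "0 \<le> t" "t < 1" "0 \<le> q" "0 \<le> \<kappa>"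
    and trivial: "X \<le> 2 * \<kappa> * (t * g / 2)" and quadratic: "t * g / 2 \<le> g / 4 \<Longrightarrow> X \<le> q"
  shows "X \<le> q + 4 * \<kappa> * g * (t ^ 3 / (1 - t))"
proof (cases "t \<le> 1 / 2")
  case True
  then have "t * g / 2 \<le> g / 4" using assms(1) by simp
  then have "X \<le> q" by (rule quadratic)
  moreover have "0 \<le> 4 * \<kappa> * g * (t ^ 3 / (1 - t))" using assms by simp
  ultimately show ?thesis by linarith
next
  case False
  then have "(1 / 2)\<^sup>2 \<le> t\<^sup>2" by (intro power_mono) auto
  then have "t * 1 \<le> t * (4 * t\<^sup>2)" using assms(2) by (intro mult_left_mono) (simp_all add: power2_eq_square)
  also have "\<dots> = 4 * t ^ 3" by (simp add: power2_eq_square power3_eq_cube)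
  also have "\<dots> \<le> 4 * (t ^ 3 / (1 - t))"
    using assms by (simp add: field_simps)
  finally have "\<kappa> * g * t \<le> \<kappa> * g * (4 * (t ^ 3 / (1 - t)))"
    using assms by (intro mult_left_mono) auto
  then show ?thesis using trivial assms(4) by (simp add: mult_ac)
qed

lemma sum_Suc_shift: "(\<Sum>j=k + 1..d. f j) = (\<Sum>j=k..<d. f (Suc j))" for f :: "nat \<Rightarrow> real"
  by (simp add: sum.shift_bounds_Suc_ivl[symmetric] atLeastLessThanSuc_atLeastAtMost)

lemma sum_from_1_shift: "(\<Sum>j=1..d. f j) = (\<Sum>j<d. f (Suc j))" for f :: "nat \<Rightarrow> real"
  using sum_Suc_shift[of f 0 d] by (simp add: atLeast0LessThan)

lemma sum_rev_sort: "(\<Sum>j<d. rev (sort (map x [0..<d])) ! j) = (\<Sum>c<d. x c)" for x :: "nat \<Rightarrow> real"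
proof -
  have "(\<Sum>j<d. rev (sort (map x [0..<d])) ! j) = sum_list (rev (sort (map x [0..<d])))"
    by (simp add: sum_list_sum_nth atLeast0LessThan)
  also have "\<dots> = sum_list (map x [0..<d])"
    by (metis mset_rev mset_sort sum_mset_sum_list)
  finally show ?thesis by (simp add: interv_sum_list_conv_sum_set_nat atLeast0LessThan)
qed

section \<open>The rounded matrix: expected first-order and second-order effects\<close>

context
  fixes n d k B :: nat and R :: real and A :: "real mat"
  assumes inst: "rounding_instance n d R B A" and k: "1 \<le> k" "k < d"
begin

lemma rounding_instanceD:
  shows carrier: "A \<in> carrier_mat n d" and R_pos: "0 < R" and B_ge_1: "1 \<le> B"
    and entries: "\<And>r c. r < n \<Longrightarrow> c < d \<Longrightarrow> \<bar>A $$ (r, c)\<bar> \<le> R"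
  using inst by (auto simp: rounding_instance_def)

interpretation centered_bounded_matrix n d "\<lambda>ij. stoch_round R B (A $$ ij)" 0 "resolution R B" "\<lambda>ij. A $$ ij"
proof
  show "finite ({..<n} \<times> {..<d})" by simp
  show "finite (set_pmf (stoch_round R B (A $$ ij)))" if "ij \<in> {..<n} \<times> {..<d}" for ij
    using that stoch_round(1)[OF R_pos B_ge_1] entries by auto
  show "measure_pmf.expectation (stoch_round R B (A $$ ij)) (\<lambda>x. x) = A $$ ij"
    if "ij \<in> {..<n} \<times> {..<d}" for ij
    using that stoch_round(3)[OF R_pos B_ge_1] entries by auto
  show "\<bar>x - A $$ ij\<bar> \<le> resolution R B"
    if "ij \<in> {..<n} \<times> {..<d}" "x \<in> set_pmf (stoch_round R B (A $$ ij))" for ij x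
    using that stoch_round(2)[OF R_pos B_ge_1] entries by auto
  show "0 \<le> resolution R B" using resolution_pos[OF R_pos B_ge_1] by simp
qed

abbreviation law :: "(nat \<times> nat \<Rightarrow> real) pmf" where
  "law \<equiv> Pi_pmf ({..<n} \<times> {..<d}) 0 (\<lambda>ij. stoch_round R B (A $$ ij))"

lemma stoch_round_mat_law: "stoch_round_mat R B A = map_pmf (Matrix.mat n d) law"
  using carrier by (simp add: stoch_round_mat_def)

lemma column_variance_colvar:
  assumes "c < d"
  shows "column_variance R B A c = colvar c"
  unfolding column_variance_def colvar_def
proof (rule sum.cong)
  show "{..<dim_row A} = {..<n}" using carrier by simp
  fix r assume "r \<in> {..<n}"
  then have r: "r < n" by simp
  then have entry: "(Matrix.mat n d f - A) $$ (r, c) = e f (r, c)" for f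
    using carrier assms by simp
  show "measure_pmf.variance (stoch_round_mat R B A) (\<lambda>A'. (A' - A) $$ (r, c)) = E (\<lambda>f. (e f (r, c))\<^sup>2)"
    unfolding stoch_round_mat_law integral_map_pmf entry using r assms by (simp add: E_e)
qed

lemma colvar_nonneg: "0 \<le> colvar c"
  unfolding colvar_def by (intro sum_nonneg Bochner_Integration.integral_nonneg) auto

lemma column_variance_desc_eq:
  "column_variance_desc R B A (Suc j) = rev (sort (map colvar [0..<d])) ! j"
proof -
  have "map (column_variance R B A) [0..<dim_col A] = map colvar [0..<d]"
    using carrier by (intro map_cong) (auto simp: column_variance_colvar)
  then show ?thesis by (simp add: column_variance_desc_def)
qed

lemma mv_noise: "r < n \<Longrightarrow> mv (Matrix.mat n d f) d x r = mv A d x r + Ev f x r"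
  by (simp add: left_diff_distrib sum_subtractf)

lemma E_Ev: "r < n \<Longrightarrow> E (\<lambda>f. Ev f x r) = 0"
  by (simp add: E_sum E_e)

lemma gram_diff_noise:
  "gram_diff A (Matrix.mat n d f) n d v i j =
    (\<Sum>r<n. mv A d (v i) r * Ev f (v j) r + mv A d (v j) r * Ev f (v i) r + Ev f (v i) r * Ev f (v j) r)"
  unfolding gram_diff_def sum_subtractf[symmetric]
proof (rule sum.cong[OF refl])
  fix r assume "r \<in> {..<n}"
  then have r: "r < n" by simp
  show "mv (Matrix.mat n d f) d (v i) r * mv (Matrix.mat n d f) d (v j) r - mv A d (v i) r * mv A d (v j) r
    = mv A d (v i) r * Ev f (v j) r + mv A d (v j) r * Ev f (v i) r + Ev f (v i) r * Ev f (v j) r"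
    unfolding mv_noise[OF r] by (simp only: distrib_left distrib_right) (simp add: mult.commute)
qed

text \<open>The terms linear in the noise are centered; only the diagonal matrix of column variances
  survives.\<close>

lemma E_gram_diff_diag:
  "E (\<lambda>f. gram_diff A (Matrix.mat n d f) n d v i i) = (\<Sum>c<d. colvar c * (v i c)\<^sup>2)"
proof -
  have "E (\<lambda>f. gram_diff A (Matrix.mat n d f) n d v i i) = (\<Sum>r<n. \<Sum>c<d. E (\<lambda>f. (e f (r, c))\<^sup>2) * (v i c * v i c))"
    unfolding gram_diff_noise E_sum[of _ "{..<n}"]
  proof (rule sum.cong[OF refl])
    fix r assume "r \<in> {..<n}"
    then have r: "r < n" by simp
    show "E (\<lambda>f. mv A d (v i) r * Ev f (v i) r + mv A d (v i) r * Ev f (v i) r + Ev f (v i) r * Ev f (v i) r)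
      = (\<Sum>c<d. E (\<lambda>f. (e f (r, c))\<^sup>2) * (v i c * v i c))"
      unfolding E_row_product[OF r, symmetric]
      by (simp only: E_add integral_mult_right_zero E_Ev[OF r])
  qed
  also have "\<dots> = (\<Sum>c<d. colvar c * (v i c)\<^sup>2)"
    unfolding colvar_def by (subst sum.swap) (simp add: sum_distrib_right power2_eq_square)
  finally show ?thesis .
qed

lemma E_frobenius:
  "E (\<lambda>f. (\<Sum>r<n. \<Sum>c<d. (f (r, c))\<^sup>2) - (\<Sum>r<n. \<Sum>c<d. (A $$ (r, c))\<^sup>2)) = (\<Sum>c<d. colvar c)"
proof -
  have "(f (r, c))\<^sup>2 - (A $$ (r, c))\<^sup>2 = 2 * A $$ (r, c) * e f (r, c) + (e f (r, c))\<^sup>2"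
    for f :: "nat \<times> nat \<Rightarrow> real" and r c
    by (simp add: power2_eq_square algebra_simps)
  then have "E (\<lambda>f. (\<Sum>r<n. \<Sum>c<d. (f (r, c))\<^sup>2) - (\<Sum>r<n. \<Sum>c<d. (A $$ (r, c))\<^sup>2))
      = E (\<lambda>f. \<Sum>r<n. \<Sum>c<d. 2 * A $$ (r, c) * e f (r, c) + (e f (r, c))\<^sup>2)"
    by (simp only: sum_subtractf[symmetric])
  also have "\<dots> = (\<Sum>r<n. \<Sum>c<d. 2 * A $$ (r, c) * E (\<lambda>f. e f (r, c)) + E (\<lambda>f. (e f (r, c))\<^sup>2))"
    unfolding E_sum E_add integral_mult_right_zero ..
  also have "\<dots> = (\<Sum>r<n. \<Sum>c<d. E (\<lambda>f. (e f (r, c))\<^sup>2))"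
    by (intro sum.cong refl) (simp add: E_e)
  also have "\<dots> = (\<Sum>c<d. colvar c)"
    unfolding colvar_def by (rule sum.swap)
  finally show ?thesis .
qed

lemma tail_energy_eq:
  assumes "M \<in> carrier_mat n d"
  shows "(\<Sum>i=k + 1..d. (singular_value i M)\<^sup>2)
    = (\<Sum>r<n. \<Sum>c<d. (M $$ (r, c))\<^sup>2) - (\<Sum>a<k. (singular_value (Suc a) M)\<^sup>2)"
  unfolding sum_Suc_shift sum_singular_values_squared[OF assms, symmetric]
  using k by (simp add: sum_lessThan_split_nat[of k d])

context
  fixes v :: "nat \<Rightarrow> nat \<Rightarrow> real"
  assumes v: "gram_basis A n d v"
begin

abbreviation D :: "(nat \<times> nat \<Rightarrow> real) \<Rightarrow> nat \<Rightarrow> nat \<Rightarrow> real" where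
  "D f \<equiv> gram_diff A (Matrix.mat n d f) n d v"

definition head_excess :: "(nat \<times> nat \<Rightarrow> real) \<Rightarrow> real" where
  "head_excess f = (\<Sum>a<k. (singular_value (Suc a) (Matrix.mat n d f))\<^sup>2)
     - (\<Sum>a<k. (singular_value (Suc a) A)\<^sup>2) - (\<Sum>i<k. D f i i)"

text \<open>The diagonal of the orthogonal projection onto the top \<open>k\<close> singular
  directions; its entries lie in [0,1] and sum to \<open>k\<close>, as
  \<open>sum_weighted_le_top\<close> requires.\<close>

definition weight :: "nat \<Rightarrow> real" where "weight c = (\<Sum>i<k. (v i c)\<^sup>2)"

lemma v_rows: "a < d \<Longrightarrow> b < d \<Longrightarrow> (\<Sum>i<d. v a i * v b i) = (if a = b then 1 else 0)"
  and v_cols: "i < d \<Longrightarrow> j < d \<Longrightarrow> (\<Sum>a<d. v a i * v a j) = (if i = j then 1 else 0)"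
  and v_gram: "a < d \<Longrightarrow> b < d \<Longrightarrow> (\<Sum>r<n. mv A d (v a) r * mv A d (v b) r)
        = (if a = b then (singular_value (Suc a) A)\<^sup>2 else 0)"
  using v by (auto simp: gram_basis_def)

lemma v_unit: "a < d \<Longrightarrow> (\<Sum>i<d. (v a i)\<^sup>2) = 1"
  using v_rows[of a a] by (simp add: power2_eq_square)

lemma weighted_colvar_le:
  assumes "mono_on {0..} \<phi>"
  shows "(\<Sum>c<d. weight c * \<phi> (colvar c)) \<le> (\<Sum>j<k. \<phi> (column_variance_desc R B A (Suc j)))"
  unfolding column_variance_desc_eq
proof (rule sum_weighted_le_top[OF k(1) _ _ _ _ _ assms])
  show "0 \<le> weight c" for c by (simp add: weight_def sum_nonneg)
  show "weight c \<le> 1" if "c < d" for c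
  proof -
    have "weight c \<le> (\<Sum>i<d. (v i c)\<^sup>2)"
      unfolding weight_def using k by (intro sum_mono2) auto
    then show ?thesis using v_cols[OF that that] by (simp add: power2_eq_square)
  qed
  have "(\<Sum>c<d. weight c) = (\<Sum>i<k. \<Sum>c<d. (v i c)\<^sup>2)" unfolding weight_def by (rule sum.swap)
  also have "\<dots> = (\<Sum>i<k. 1)" using k by (intro sum.cong refl) (simp add: v_unit)
  finally show "(\<Sum>c<d. weight c) = real k" by simp
qed (use k colvar_nonneg in auto)

text \<open>The tail energy is the Frobenius energy minus the head. On average the former grows by
  the sum of all column variances, and the first-order part of the head by their weighted sum, which
  is at most the k largest. What is left is at least the d - k smallest, minus
  \<open>head_excess\<close>.\<close>

lemma excess_tail_energy_ge:
  "excess_tail_energy R B k A \<ge> (\<Sum>j=k + 1..d. column_variance_desc R B A j) - E head_excess"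
proof -
  have M: "Matrix.mat n d f \<in> carrier_mat n d" for f :: "nat \<times> nat \<Rightarrow> real" by simp
  have entries_f: "(\<Sum>r<n. \<Sum>c<d. (Matrix.mat n d f $$ (r, c))\<^sup>2) = (\<Sum>r<n. \<Sum>c<d. (f (r, c))\<^sup>2)"
    for f :: "nat \<times> nat \<Rightarrow> real"
    by (intro sum.cong refl) simp
  have dA: "dim_col A = d" using carrier by simp
  let ?T = "\<Sum>i=k + 1..d. (singular_value i A)\<^sup>2"
  define Fr where "Fr f = (\<Sum>r<n. \<Sum>c<d. (f (r, c))\<^sup>2) - (\<Sum>r<n. \<Sum>c<d. (A $$ (r, c))\<^sup>2)"
    for f :: "nat \<times> nat \<Rightarrow> real"
  have "excess_tail_energy R B k A = E (\<lambda>f. \<Sum>i=k + 1..d. (singular_value i (Matrix.mat n d f))\<^sup>2) - ?T"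
    unfolding excess_tail_energy_def dA stoch_round_mat_law by simp
  also have "\<dots> = E (\<lambda>f. (\<Sum>i=k + 1..d. (singular_value i (Matrix.mat n d f))\<^sup>2) - ?T)"
    by (simp add: E_diff)
  also have "\<dots> = E (\<lambda>f. Fr f - (\<Sum>i<k. D f i i) - head_excess f)"
    unfolding Fr_def tail_energy_eq[OF M] tail_energy_eq[OF carrier] entries_f head_excess_def
    by (intro arg_cong[of _ _ E] ext) linarith
  also have "\<dots> = (\<Sum>c<d. colvar c) - (\<Sum>i<k. \<Sum>c<d. colvar c * (v i c)\<^sup>2) - E head_excess"
    by (simp only: E_diff E_frobenius[folded Fr_def] E_sum E_gram_diff_diag)
  also have "(\<Sum>i<k. \<Sum>c<d. colvar c * (v i c)\<^sup>2) = (\<Sum>c<d. weight c * colvar c)"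
    unfolding weight_def by (subst sum.swap) (simp add: sum_distrib_right mult.commute)
  finally have *: "excess_tail_energy R B k A
      = (\<Sum>c<d. colvar c) - (\<Sum>c<d. weight c * colvar c) - E head_excess" .
  have "(\<Sum>c<d. weight c * colvar c) \<le> (\<Sum>j<k. column_variance_desc R B A (Suc j))"
    using weighted_colvar_le[of "\<lambda>x. x"] by (simp add: mono_on_def)
  moreover have "(\<Sum>c<d. colvar c) = (\<Sum>j<d. column_variance_desc R B A (Suc j))"
    unfolding column_variance_desc_eq sum_rev_sort ..
  ultimately show ?thesis
    using k unfolding * sum_Suc_shift by (simp add: sum_lessThan_split_nat[of k d])
qed

text \<open>The mean part \<open>b i j\<close> of the chaos is the form of the diagonal matrix of
  column variances at \<open>v i\<close> and \<open>v j\<close>. Extending \<open>j\<close> to the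
  full basis, Parseval gives a weighted sum of squared variances, again bounded by the k largest.
  The constant 9 is 3 for the three terms times 3 from the fourth moment.\<close>

lemma E_cross_terms_le:
  "E (\<lambda>f. \<Sum>i<k. \<Sum>j=k..<d. (D f i j)\<^sup>2)
    \<le> 9 * ((resolution R B)\<^sup>2 * (\<Sum>i<k. \<Sum>j=k..<d. (singular_value (Suc i) A)\<^sup>2 + (singular_value (Suc j) A)\<^sup>2)
        + (\<Sum>j<k. (column_variance_desc R B A (Suc j))\<^sup>2)
        + (resolution R B) ^ 4 * real n * real k * real (d - k))"
proof -
  define \<rho> where "\<rho> = resolution R B"
  define L where "L i = (singular_value (Suc i) A)\<^sup>2" for i
  define b where "b i j = (\<Sum>c<d. colvar c * v i c * v j c)" for i j
  have entry: "E (\<lambda>f. (D f i j)\<^sup>2) \<le> 3 * (\<rho>\<^sup>2 * (L i + L j) + (b i j)\<^sup>2 + 3 * \<rho> ^ 4 * real n)"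
    if "i < d" "j < d" for i j
    using gram_perturbation_entry_second_moment[OF v_unit v_unit, OF that, of "mv A d (v i)" "mv A d (v j)"]
      v_gram[of i i] v_gram[of j j] that
    unfolding gram_diff_noise \<rho>_def b_def L_def by (simp add: power2_eq_square)
  have "(\<Sum>i<k. \<Sum>j=k..<d. (b i j)\<^sup>2) \<le> (\<Sum>i<k. \<Sum>j<d. (b i j)\<^sup>2)"
    by (intro sum_mono sum_mono2) auto
  also have "\<dots> = (\<Sum>i<k. \<Sum>c<d. (colvar c * v i c) * (colvar c * v i c))"
    unfolding b_def power2_eq_square by (intro sum.cong refl parseval v_cols)
  also have "\<dots> = (\<Sum>c<d. weight c * (colvar c)\<^sup>2)"
    unfolding weight_def by (subst sum.swap) (simp add: sum_distrib_right power2_eq_square mult_ac)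
  also have "\<dots> \<le> (\<Sum>j<k. (column_variance_desc R B A (Suc j))\<^sup>2)"
    by (rule weighted_colvar_le) (auto simp: mono_on_def intro: power_mono)
  finally have b: "(\<Sum>i<k. \<Sum>j=k..<d. (b i j)\<^sup>2) \<le> (\<Sum>j<k. (column_variance_desc R B A (Suc j))\<^sup>2)" .
  have "E (\<lambda>f. \<Sum>i<k. \<Sum>j=k..<d. (D f i j)\<^sup>2) = (\<Sum>i<k. \<Sum>j=k..<d. E (\<lambda>f. (D f i j)\<^sup>2))"
    by (simp only: E_sum)
  also have "\<dots> \<le> (\<Sum>i<k. \<Sum>j=k..<d. 3 * (\<rho>\<^sup>2 * (L i + L j) + (b i j)\<^sup>2 + 3 * \<rho> ^ 4 * real n))"
    using k by (intro sum_mono entry) auto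
  also have "\<dots> = 3 * (\<rho>\<^sup>2 * (\<Sum>i<k. \<Sum>j=k..<d. L i + L j) + (\<Sum>i<k. \<Sum>j=k..<d. (b i j)\<^sup>2)
      + 3 * (\<rho> ^ 4 * real n * real k * real (d - k)))"
    by (simp only: sum.distrib sum_distrib_left[symmetric]) simp
  also have "\<dots> \<le> 9 * (\<rho>\<^sup>2 * (\<Sum>i<k. \<Sum>j=k..<d. L i + L j)
        + (\<Sum>j<k. (column_variance_desc R B A (Suc j))\<^sup>2) + \<rho> ^ 4 * real n * real k * real (d - k))"
  proof -
    have "0 \<le> \<rho>\<^sup>2 * (\<Sum>i<k. \<Sum>j=k..<d. L i + L j)"
      by (intro mult_nonneg_nonneg sum_nonneg add_nonneg_nonneg) (auto simp: L_def)
    moreover have "0 \<le> (\<Sum>j<k. (column_variance_desc R B A (Suc j))\<^sup>2)" by (simp add: sum_nonneg)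
    moreover have "0 \<le> \<rho> ^ 4 * real n * real k * real (d - k)" by simp
    ultimately show ?thesis using b unfolding distrib_left by linarith
  qed
  finally show ?thesis unfolding \<rho>_def L_def .
qed

lemma head_excess_le:
  fixes t :: real
  defines "g \<equiv> (singular_value k A)\<^sup>2 - (singular_value (k + 1) A)\<^sup>2"
  assumes g: "0 < g" and t: "0 \<le> t" "t < 1"
    and form: "\<And>x. \<bar>(\<Sum>r<n. (mv (Matrix.mat n d f) d x r)\<^sup>2) - (\<Sum>r<n. (mv A d x r)\<^sup>2)\<bar>
      \<le> t * g / 2 * (\<Sum>c<d. (x c)\<^sup>2)"
  shows "head_excess f \<le> 2 / g * (\<Sum>i<k. \<Sum>j=k..<d. (D f i j)\<^sup>2) + 4 * real k * g * (t ^ 3 / (1 - t))"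
proof -
  obtain w where w: "gram_basis (Matrix.mat n d f) n d w"
    using gram_basis_exists[of "Matrix.mat n d f" n d] by auto
  interpret pe: perturbed_eigenbasis d k "\<lambda>a i. \<Sum>b<d. w a b * v i b" "D f"
    "\<lambda>i. (singular_value (Suc i) A)\<^sup>2" "\<lambda>a. (singular_value (Suc a) (Matrix.mat n d f))\<^sup>2" g "t * g / 2"
    unfolding g_def by (rule perturbed_eigenbasis_gram[OF carrier k v w form[unfolded g_def]])
  have "head_excess f \<le> 2 / g * pe.F2 + 4 * real k * g * (t ^ 3 / (1 - t))"
    using pe.excess_le_trivial pe.excess_le_quadratic pe.F2_nonneg g t
    by (intro cubic_remainder) (auto simp: head_excess_def)
  then show ?thesis unfolding pe.F2_def .
qed

text \<open>Uses \<alpha> on the event of small spectral norm and the worst-case \<beta> on its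
  complement, whose probability is at most \<open>q\<close>.\<close>

lemma E_head_excess_le:
  fixes \<alpha> \<beta> q :: real
  defines "g \<equiv> (singular_value k A)\<^sup>2 - (singular_value (k + 1) A)\<^sup>2"
  assumes g: "0 < g" and \<alpha>: "0 \<le> \<alpha>" "\<alpha> < 1" and \<beta>: "\<beta> < 1"
    and \<beta>_eq: "\<beta> * g / 2 = 2 * singular_value 1 A * resolution R B * sqrt (real n * real d)
        + (resolution R B)\<^sup>2 * real n * real d"
    and likely: "measure_pmf.prob (stoch_round_mat R B A)
      {A'. spectral_norm (transpose_mat A' * A' - transpose_mat A * A) \<le> \<alpha> * g / 2} \<ge> 1 - q"
  shows "E head_excess \<le> 2 / g * E (\<lambda>f. \<Sum>i<k. \<Sum>j=k..<d. (D f i j)\<^sup>2)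
    + 4 * real k * g * (\<alpha> ^ 3 / (1 - \<alpha>) + q * (\<beta> ^ 3 / (1 - \<beta>)))"
proof -
  have "0 \<le> \<beta> * g / 2"
    unfolding \<beta>_eq using singular_value_nonneg[OF carrier, of 0] resolution_pos[OF R_pos B_ge_1] k by simp
  then have \<beta>0: "0 \<le> \<beta>" using g by (simp add: zero_le_mult_iff)
  define F2 where "F2 f = (\<Sum>i<k. \<Sum>j=k..<d. (D f i j)\<^sup>2)" for f
  define ra where "ra = 4 * real k * g * (\<alpha> ^ 3 / (1 - \<alpha>))"
  define rb where "rb = 4 * real k * g * (\<beta> ^ 3 / (1 - \<beta>))"
  have ra: "0 \<le> ra" and rb: "0 \<le> rb" using g \<alpha> \<beta> \<beta>0 by (simp_all add: ra_def rb_def)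
  define good where "good = {f. spectral_norm (transpose_mat (Matrix.mat n d f) * Matrix.mat n d f
    - transpose_mat A * A) \<le> \<alpha> * g / 2}"
  \<comment> \<open>The quadratic term is the same on both events, so its moment is taken under the
    full law and no conditioning on \<open>good\<close> occurs. Off \<open>good\<close>, the
    nonnegative \<open>ra\<close> is simply added.\<close>
  have pointwise: "head_excess f \<le> 2 / g * F2 f + ra + rb * indicator (- good) f"
    if f: "f \<in> set_pmf law" for f
  proof (cases "f \<in> good")
    case True
    have "\<bar>(\<Sum>r<n. (mv (Matrix.mat n d f) d x r)\<^sup>2) - (\<Sum>r<n. (mv A d x r)\<^sup>2)\<bar>
      \<le> \<alpha> * g / 2 * (\<Sum>c<d. (x c)\<^sup>2)" for x
    proof -
      have "spectral_norm (transpose_mat (Matrix.mat n d f) * Matrix.mat n d f - transpose_mat A * A)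
          * (\<Sum>c<d. (x c)\<^sup>2) \<le> \<alpha> * g / 2 * (\<Sum>c<d. (x c)\<^sup>2)"
        using True by (intro mult_right_mono sum_nonneg) (auto simp: good_def)
      then show ?thesis
        using gram_form_spectral[OF carrier mat_carrier, of f x] by linarith
    qed
    from head_excess_le[OF g[unfolded g_def] \<alpha> this[unfolded g_def]] show ?thesis
      using True by (simp add: F2_def ra_def g_def)
  next
    case False
    have "\<bar>Matrix.mat n d f $$ (r, c) - A $$ (r, c)\<bar> \<le> resolution R B" if "r < n" "c < d" for r c
      using e_bound[of "(r, c)" f] that f by simp
    then have "\<bar>(\<Sum>r<n. (mv (Matrix.mat n d f) d x r)\<^sup>2) - (\<Sum>r<n. (mv A d x r)\<^sup>2)\<bar>
      \<le> \<beta> * g / 2 * (\<Sum>c<d. (x c)\<^sup>2)" for x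
      unfolding \<beta>_eq using resolution_pos[OF R_pos B_ge_1] k by (intro gram_form_bounded_noise[OF carrier]) auto
    from head_excess_le[OF g[unfolded g_def] \<beta>0 \<beta> this[unfolded g_def]] show ?thesis
      using False ra by (simp add: F2_def rb_def g_def)
  qed
  have "E head_excess \<le> E (\<lambda>f. 2 / g * F2 f + ra + rb * indicator (- good) f)"
    by (intro E_mono pointwise)
  also have "\<dots> = 2 / g * E F2 + ra + rb * measure_pmf.prob law (- good)"
    by (simp add: E_add)
  finally have bound: "E head_excess \<le> 2 / g * E F2 + ra + rb * measure_pmf.prob law (- good)" .
  have "measure_pmf.prob law (- good) \<le> q"
    using likely measure_pmf.prob_compl[of good law]
    unfolding stoch_round_mat_law measure_map_pmf by (simp add: good_def vimage_def Compl_eq_Diff_UNIV)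
  then have "rb * measure_pmf.prob law (- good) \<le> rb * q" using rb by (rule mult_left_mono)
  then have "E head_excess \<le> 2 / g * E F2 + ra + rb * q" using bound by linarith
  moreover have split: "4 * real k * g * (x + q * y) = 4 * real k * g * x + 4 * real k * g * y * q" for x y
    by (simp add: algebra_simps)
  ultimately show ?thesis unfolding F2_def ra_def rb_def split add.assoc by simp
qed

end

end

text \<open>The constant 18 is the 9 of \<open>E_cross_terms_le\<close> times the 2/g of the
  quadratic bound. The same 18 is ample for the remainder, where only the factor 4 is
  required.\<close>

lemma excess_tail_energy_lower_bound:
  fixes C\<^sub>\<Delta> c\<^sub>1 c\<^sub>2 :: real
  assumes pos: "C\<^sub>\<Delta> > 0" "c\<^sub>1 > 0"
    and tail: "gram_tail_bound C\<^sub>\<Delta> c\<^sub>1 c\<^sub>2"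
    and inst: "rounding_instance n d R B A" and rank: "full_column_rank A"
    and nd: "d \<le> n" and k: "1 \<le> k" "k < d"
  defines "\<rho> \<equiv> resolution R B" and "lam \<equiv> \<lambda>i. (singular_value i A)\<^sup>2"
    and "\<nu> \<equiv> column_variance_desc R B A"
  defines "g \<equiv> lam k - lam (k + 1)"
  defines "\<alpha> \<equiv> 2 / g * C\<^sub>\<Delta> * (singular_value 1 A * \<rho> * sqrt (real d) + \<rho>\<^sup>2 * real n)"
    and "\<beta> \<equiv> 2 / g * (2 * singular_value 1 A * \<rho> * sqrt (real n * real d) + \<rho>\<^sup>2 * real n * real d)"
  assumes g: "g > 0" and \<alpha>1: "\<alpha> < 1" and \<beta>1: "\<beta> < 1"
  shows "excess_tail_energy R B k A \<ge> (\<Sum>j = k + 1..d. \<nu> j)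
    - 18 / g * (\<rho>\<^sup>2 * (\<Sum>i = 1..k. \<Sum>j = k + 1..d. (lam i + lam j))
                + (\<Sum>j = 1..k. (\<nu> j)\<^sup>2) + \<rho> ^ 4 * real n * real k * real (d - k))
    - 18 * real d / g * (2 * (lam 1 - lam k) + pi * g) * (lam 1 + g / 2)
        * (\<alpha> ^ 3 / (1 - \<alpha>) + c\<^sub>1 * exp (- c\<^sub>2 * real d) * (\<beta> ^ 3 / (1 - \<beta>)))"
proof -
  note A = rounding_instanceD(1)[OF inst k] and R = rounding_instanceD(2)[OF inst k] and B = rounding_instanceD(3)[OF inst k]
  obtain v where v: "gram_basis A n d v" using gram_basis_exists[OF A] .
  have \<rho>: "0 < \<rho>" unfolding \<rho>_def by (rule resolution_pos[OF R B])
  have \<sigma>: "0 \<le> singular_value 1 A" using singular_value_nonneg[OF A, of 0] k by simp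
  have \<alpha>0: "0 \<le> \<alpha>" and \<beta>0: "0 \<le> \<beta>" using g pos \<rho> \<sigma> by (simp_all add: \<alpha>_def \<beta>_def)
  have \<alpha>_eq: "\<alpha> * g / 2 = C\<^sub>\<Delta> * (singular_value 1 A * \<rho> * sqrt (real d) + \<rho>\<^sup>2 * real n)"
    and \<beta>_eq: "\<beta> * g / 2 = 2 * singular_value 1 A * \<rho> * sqrt (real n * real d) + \<rho>\<^sup>2 * real n * real d"
    using g by (simp_all add: \<alpha>_def \<beta>_def)
  define q where "q = c\<^sub>1 * exp (- c\<^sub>2 * real d)"
  define W where "W = \<alpha> ^ 3 / (1 - \<alpha>) + q * (\<beta> ^ 3 / (1 - \<beta>))"
  have W: "0 \<le> W" using \<alpha>0 \<alpha>1 \<beta>0 \<beta>1 pos by (simp add: W_def q_def)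
  have likely: "measure_pmf.prob (stoch_round_mat R B A)
      {A'. spectral_norm (transpose_mat A' * A' - transpose_mat A * A) \<le> \<alpha> * g / 2} \<ge> 1 - q"
    using tail inst rank nd k unfolding gram_tail_bound_def \<alpha>_eq \<rho>_def q_def by simp
  define S where "S = \<rho>\<^sup>2 * (\<Sum>i = 1..k. \<Sum>j = k + 1..d. (lam i + lam j))
                + (\<Sum>j = 1..k. (\<nu> j)\<^sup>2) + \<rho> ^ 4 * real n * real k * real (d - k)"
  let ?E = "measure_pmf.expectation (law n d B R A)"
  have cross: "?E (\<lambda>f. \<Sum>i<k. \<Sum>j=k..<d. (D n d A v f i j)\<^sup>2) \<le> 9 * S"
    using E_cross_terms_le[OF inst k v] unfolding S_def sum_from_1_shift sum_Suc_shift lam_def \<nu>_def \<rho>_def .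
  have "2 / g * ?E (\<lambda>f. \<Sum>i<k. \<Sum>j=k..<d. (D n d A v f i j)\<^sup>2) \<le> 2 / g * (9 * S)"
    using g by (intro mult_left_mono cross) auto
  moreover have "?E (head_excess n d k A v)
      \<le> 2 / g * ?E (\<lambda>f. \<Sum>i<k. \<Sum>j=k..<d. (D n d A v f i j)\<^sup>2) + 4 * real k * g * W"
    using E_head_excess_le[OF inst k v g[unfolded g_def lam_def] \<alpha>0 \<alpha>1 \<beta>1
        \<beta>_eq[unfolded g_def lam_def \<rho>_def] likely[unfolded g_def lam_def]]
    unfolding W_def g_def lam_def .
  ultimately have head: "?E (head_excess n d k A v) \<le> 18 / g * S + 4 * real k * g * W"
    by simp
  have "k - 1 < d" using k by simp
  then have lamk: "lam k \<le> lam 1"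
    using singular_value_antimono[OF A, of 0 "k - 1"] k by (simp add: lam_def)
  moreover have "0 \<le> lam (k + 1)" by (simp add: lam_def)
  ultimately have lam1: "g \<le> lam 1" unfolding g_def by linarith
  \<comment> \<open>The coefficient 4kg is absorbed using k < d, \<pi> g >= g and \<lambda>_1 >= g,
    the last because \<lambda>_{k+1} is nonnegative.\<close>
  have "4 * real k * g * W \<le> 18 * real d / g * (2 * (lam 1 - lam k) + pi * g) * (lam 1 + g / 2) * W"
  proof (rule mult_right_mono[OF _ W])
    have "4 * real k * g \<le> 18 * real d / g * (1 * g) * g" using k g by simp
    also have "\<dots> \<le> 18 * real d / g * (2 * (lam 1 - lam k) + pi * g) * (lam 1 + g / 2)"
    proof (intro mult_mono)
      have "1 * g \<le> pi * g" using g pi_gt3 by (intro mult_right_mono) auto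
      moreover have "0 \<le> 2 * (lam 1 - lam k)" using lamk by simp
      ultimately show "1 * g \<le> 2 * (lam 1 - lam k) + pi * g" by linarith
      show "g \<le> lam 1 + g / 2" using lam1 g by linarith
      show "0 \<le> 18 * real d / g * (2 * (lam 1 - lam k) + pi * g)" using g lamk pi_gt_zero by simp
    qed (use g in auto)
    finally show "4 * real k * g \<le> 18 * real d / g * (2 * (lam 1 - lam k) + pi * g) * (lam 1 + g / 2)" .
  qed
  then show ?thesis
    using excess_tail_energy_ge[OF inst k v] head
    unfolding \<nu>_def[symmetric] S_def[symmetric] q_def[symmetric] W_def[symmetric] by linarith
qed

theorem mainTheorem3:
  fixes C\<^sub>\<Delta> c\<^sub>1 c\<^sub>2 :: real
  assumes "C\<^sub>\<Delta> > 0" and "c\<^sub>1 > 0" and "c\<^sub>2 > 0"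
    and "gram_tail_bound C\<^sub>\<Delta> c\<^sub>1 c\<^sub>2"
  shows "\<exists>C>0. \<forall>(n::nat) (d::nat) (k::nat) (R::real) (B::nat) (A::real mat).
    (let \<rho> = resolution R B;
         \<sigma>\<^sub>1 = singular_value 1 A;
         lam = (\<lambda>i. (singular_value i A)\<^sup>2);
         \<nu> = column_variance_desc R B A;
         g = lam k - lam (k + 1);
         \<alpha> = 2 / g * C\<^sub>\<Delta> * (\<sigma>\<^sub>1 * \<rho> * sqrt (real d) + \<rho>\<^sup>2 * real n);
         \<beta> = 2 / g * (2 * \<sigma>\<^sub>1 * \<rho> * sqrt (real n * real d) + \<rho>\<^sup>2 * real n * real d);
         Rem = C * real d / g * (2 * (lam 1 - lam k) + pi * g) * (lam 1 + g / 2)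
                 * (\<alpha> ^ 3 / (1 - \<alpha>) + c\<^sub>1 * exp (- c\<^sub>2 * real d) * (\<beta> ^ 3 / (1 - \<beta>)))
     in d \<le> n \<and> 1 \<le> k \<and> k < d
        \<and> rounding_instance n d R B A
        \<and> full_column_rank A
        \<and> (AE A' in measure_pmf (stoch_round_mat R B A). full_column_rank A')
        \<and> g > 0 \<and> \<alpha> < 1 \<and> \<beta> < 1
      \<longrightarrow> excess_tail_energy R B k A
          \<ge> (\<Sum>j = k + 1..d. \<nu> j)
            - C / g * (\<rho>\<^sup>2 * (\<Sum>i = 1..k. \<Sum>j = k + 1..d. (lam i + lam j))
                       + (\<Sum>j = 1..k. (\<nu> j)\<^sup>2)
                       + \<rho> ^ 4 * real n * real k * real (d - k))
            - Rem)"
  unfolding Let_def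
  by (intro exI[of _ 18] conjI allI impI; (elim conjE)?;
      (rule excess_tail_energy_lower_bound[OF assms(1,2,4)])?; (assumption | simp)?)

end
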